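(* Let $G$ be a series-parallel graph with terminals $s$ and $t$, $N$ nodes and $M$ arcs, and let $\hat c_e\ge0$ and $d_e\ge0$ be arc weights. For the bicriteria shortest path problem $\min_{P\in\mathcal{P}}(\hat c(P),\ d(P))^t$ one has $|\mathcal{E}_{\min}|\le M-N+2$, and the variable-sized robust shortest path problem on $G$ with $B=\prod_{e}[-d_e,d_e]$ can be solved in polynomial time.
   Context: A (two-terminal) series-parallel graph is defined recursively: a single arc from $s$ to $t$ is series-parallel; the parallel composition of two series-parallel graphs (identifying the two sources and identifying the two sinks) and the series composition (identifying the sink of the first with the source of the second) are series-parallel; parallel arcs are allowed. Let $\mathcal{P}$ be the set of all paths from $s$ to $t$; for weights $c$ write $c(P)=\sum_{e\in P}c_e$. Let $F(P)=(\hat c(P),d(P))^t$ and $\mathcal{V}=\operatorname{conv}(\{F(P):P\in\mathcal{P}\})+\mathbb{R}^2_+$. A path $P$ is an efficient extreme solution if $F(P)$ is a vertex of $\mathcal{V}$. Two paths $P\neq P'$ are equivalent if $F(P)=F(P')$. $\mathcal{E}_{\min}$ is a maximal subset of the set of efficient extreme solutions containing no two equivalent solutions. For $\lambda\ge0$ let $\mathcal{U}_\lambda=\{\hat c\}+\lambda B$ and $\mathsf{P}(\lambda)$: $\min_{P\in\mathcal{P}}\max_{c\in\mathcal{U}_\lambda}c(P)$. Solving the variable-sized robust shortest path problem means computing a set $\mathcal{S}\subset\mathcal{P}$ of smallest possible size such that for every $\lambda\ge0$, $\mathcal{S}$ contains an optimal solution of $\mathsf{P}(\lambda)$. *)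

theory Defs
  imports
    "HOL-Analysis.Analysis"
    "HOL-Computational_Algebra.Polynomial"
    "HOL-Library.Log_Nat"
    "Graph_Theory.Digraph_Component"
begin

section \<open>Two-terminal series-parallel graphs\<close>

text \<open>
  Instead of gluing disjoint graphs along identified terminals, the two components share exactly
  the identified nodes. Since node and arc names are arbitrary this yields the same graphs.
  The condition \<open>compatible\<close> is harmless: \<open>tail\<close> and \<open>head\<close> are total functions and their values
  outside the (disjoint) arc sets of the components do not matter.
\<close>

inductive series_parallel :: "('a, 'b) pre_digraph \<Rightarrow> 'a \<Rightarrow> 'a \<Rightarrow> bool" where
  single_arc:
    "\<lbrakk>s \<noteq> t; verts G = {s, t}; arcs G = {e}; tail G e = s; head G e = t\<rbrakk>
      \<Longrightarrow> series_parallel G s t"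
| parallel:
    "\<lbrakk>series_parallel G s t; series_parallel H s t; compatible G H;
      verts G \<inter> verts H = {s, t}; arcs G \<inter> arcs H = {}\<rbrakk>
      \<Longrightarrow> series_parallel (union G H) s t"
| series:
    "\<lbrakk>series_parallel G s m; series_parallel H m t; compatible G H;
      verts G \<inter> verts H = {m}; arcs G \<inter> arcs H = {}\<rbrakk>
      \<Longrightarrow> series_parallel (union G H) s t"

definition st_paths :: "('a, 'b) pre_digraph \<Rightarrow> 'a \<Rightarrow> 'a \<Rightarrow> 'b list set" where
  "st_paths G s t = {P. pre_digraph.apath G s P t}"

text \<open>An arc list \<open>P\<close> with \<open>apath\<close> has no repeated arcs.\<close>

definition path_weight :: "('b \<Rightarrow> real) \<Rightarrow> 'b list \<Rightarrow> real" where
  "path_weight c P = (\<Sum>e\<leftarrow>P. c e)"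

section \<open>The bicriteria shortest path problem\<close>

definition objective :: "('b \<Rightarrow> real) \<Rightarrow> ('b \<Rightarrow> real) \<Rightarrow> 'b list \<Rightarrow> real \<times> real" where
  "objective c d P = (path_weight c P, path_weight d P)"

definition upper_image ::
  "('a, 'b) pre_digraph \<Rightarrow> 'a \<Rightarrow> 'a \<Rightarrow> ('b \<Rightarrow> real) \<Rightarrow> ('b \<Rightarrow> real) \<Rightarrow> (real \<times> real) set" where
  "upper_image G s t c d =
     {v + r | v r. v \<in> convex hull (objective c d ` st_paths G s t) \<and> 0 \<le> fst r \<and> 0 \<le> snd r}"

text \<open>The vertices of a polyhedron are its extreme points.\<close>

definition efficient_extreme ::
  "('a, 'b) pre_digraph \<Rightarrow> 'a \<Rightarrow> 'a \<Rightarrow> ('b \<Rightarrow> real) \<Rightarrow> ('b \<Rightarrow> real) \<Rightarrow> 'b list set" where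
  "efficient_extreme G s t c d =
     {P \<in> st_paths G s t. objective c d P extreme_point_of upper_image G s t c d}"

definition equivalent :: "('b \<Rightarrow> real) \<Rightarrow> ('b \<Rightarrow> real) \<Rightarrow> 'b list \<Rightarrow> 'b list \<Rightarrow> bool" where
  "equivalent c d P Q \<longleftrightarrow> P \<noteq> Q \<and> objective c d P = objective c d Q"

definition nonequivalent_efficient_extreme ::
  "('a, 'b) pre_digraph \<Rightarrow> 'a \<Rightarrow> 'a \<Rightarrow> ('b \<Rightarrow> real) \<Rightarrow> ('b \<Rightarrow> real) \<Rightarrow> 'b list set \<Rightarrow> bool" where
  "nonequivalent_efficient_extreme G s t c d E \<longleftrightarrow>
     E \<subseteq> efficient_extreme G s t c d \<and> (\<forall>P\<in>E. \<forall>Q\<in>E. \<not> equivalent c d P Q)"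

definition is_E_min ::
  "('a, 'b) pre_digraph \<Rightarrow> 'a \<Rightarrow> 'a \<Rightarrow> ('b \<Rightarrow> real) \<Rightarrow> ('b \<Rightarrow> real) \<Rightarrow> 'b list set \<Rightarrow> bool" where
  "is_E_min G s t c d E \<longleftrightarrow>
     nonequivalent_efficient_extreme G s t c d E \<and>
     (\<forall>E'. nonequivalent_efficient_extreme G s t c d E' \<and> E \<subseteq> E' \<longrightarrow> E' = E)"

section \<open>The variable-sized robust shortest path problem\<close>

definition uncertainty_set ::
  "('b \<Rightarrow> real) \<Rightarrow> ('b \<Rightarrow> real) set \<Rightarrow> real \<Rightarrow> ('b \<Rightarrow> real) set" where
  "uncertainty_set c B lam = {\<lambda>e. c e + lam * b e | b. b \<in> B}"

definition interval_box :: "('a, 'b) pre_digraph \<Rightarrow> ('b \<Rightarrow> real) \<Rightarrow> ('b \<Rightarrow> real) set" where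
  "interval_box G d = (\<Pi>\<^sub>E e\<in>arcs G. {- d e..d e})"

text \<open>For a path and a compact \<open>B\<close>, such as a box, the supremum is a maximum.\<close>

definition worst_case :: "('b \<Rightarrow> real) \<Rightarrow> ('b \<Rightarrow> real) set \<Rightarrow> real \<Rightarrow> 'b list \<Rightarrow> real" where
  "worst_case c B lam P = (SUP c'\<in>uncertainty_set c B lam. path_weight c' P)"

definition robust_optimal ::
  "('a, 'b) pre_digraph \<Rightarrow> 'a \<Rightarrow> 'a \<Rightarrow> ('b \<Rightarrow> real) \<Rightarrow> ('b \<Rightarrow> real) set \<Rightarrow> real \<Rightarrow> 'b list \<Rightarrow> bool"
where
  "robust_optimal G s t c B lam P \<longleftrightarrow> is_arg_min (worst_case c B lam) (\<lambda>P. P \<in> st_paths G s t) P"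

definition covers_all_sizes ::
  "('a, 'b) pre_digraph \<Rightarrow> 'a \<Rightarrow> 'a \<Rightarrow> ('b \<Rightarrow> real) \<Rightarrow> ('b \<Rightarrow> real) set \<Rightarrow> 'b list set \<Rightarrow> bool" where
  "covers_all_sizes G s t c B S \<longleftrightarrow>
     S \<subseteq> st_paths G s t \<and> (\<forall>lam\<ge>0. \<exists>P\<in>S. robust_optimal G s t c B lam P)"

definition variable_sized_solution ::
  "('a, 'b) pre_digraph \<Rightarrow> 'a \<Rightarrow> 'a \<Rightarrow> ('b \<Rightarrow> real) \<Rightarrow> ('b \<Rightarrow> real) set \<Rightarrow> 'b list set \<Rightarrow> bool" where
  "variable_sized_solution G s t c B S \<longleftrightarrow> is_arg_min card (covers_all_sizes G s t c B) S"

section \<open>A machine model with logarithmic cost\<close>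

text \<open>
  Programs are finite lists of unary first-order functions, possibly mutually recursive, that
  operate on pairs and integers. Environments are addressed by de Bruijn indices. Evaluation is
  call-by-value. Operations on pairs only copy or follow pointers and take one step. An arithmetic
  operation additionally pays for the lengths of its operands, so the length of every computed
  integer is bounded by the running time up to a constant that depends on the program. With
  shared pairs such an evaluator can be simulated by a Turing machine with polynomial overhead;
  conversely, a Turing machine is simulated with its two half-tapes as nested pairs.
\<close>

datatype data = IntD int | PairD data data

datatype arith = Plus | Minus | Times | LessEq

datatype expr =
    Var nat
  | Const int
  | Arith arith expr expr
  | MkPair expr expr
  | Fst expr
  | Snd expr
  | IsPair expr
  | Cond expr expr expr
  | Bind expr expr
  | Call nat expr

type_synonym program = "expr list"

fun apply_arith :: "arith \<Rightarrow> int \<Rightarrow> int \<Rightarrow> int" where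
  "apply_arith Plus a b = a + b"
| "apply_arith Minus a b = a - b"
| "apply_arith Times a b = a * b"
| "apply_arith LessEq a b = (if a \<le> b then 1 else 0)"

definition int_size :: "int \<Rightarrow> nat" where
  "int_size k = Suc (floorlog 2 (nat \<bar>k\<bar>))"

fun data_size :: "data \<Rightarrow> nat" where
  "data_size (IntD k) = int_size k"
| "data_size (PairD x y) = Suc (data_size x + data_size y)"

text \<open>\<open>eval p env a v n\<close>: in program \<open>p\<close>, \<open>a\<close> evaluates to \<open>v\<close> in \<open>n\<close> steps.\<close>

inductive eval :: "program \<Rightarrow> data list \<Rightarrow> expr \<Rightarrow> data \<Rightarrow> nat \<Rightarrow> bool" for p :: program where
  eval_Var: "i < length env \<Longrightarrow> eval p env (Var i) (env ! i) 1"
| eval_Const: "eval p env (Const k) (IntD k) 1"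
| eval_Arith:
    "\<lbrakk>eval p env a (IntD k) m; eval p env b (IntD l) n\<rbrakk>
      \<Longrightarrow> eval p env (Arith f a b) (IntD (apply_arith f k l)) (Suc (m + n + int_size k + int_size l))"
| eval_MkPair:
    "\<lbrakk>eval p env a x m; eval p env b y n\<rbrakk> \<Longrightarrow> eval p env (MkPair a b) (PairD x y) (Suc (m + n))"
| eval_Fst: "eval p env a (PairD x y) n \<Longrightarrow> eval p env (Fst a) x (Suc n)"
| eval_Snd: "eval p env a (PairD x y) n \<Longrightarrow> eval p env (Snd a) y (Suc n)"
| eval_IsPair_PairD: "eval p env a (PairD x y) n \<Longrightarrow> eval p env (IsPair a) (IntD 1) (Suc n)"
| eval_IsPair_IntD: "eval p env a (IntD k) n \<Longrightarrow> eval p env (IsPair a) (IntD 0) (Suc n)"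
| eval_Cond_True:
    "\<lbrakk>eval p env a (IntD k) m; k \<noteq> 0; eval p env b v n\<rbrakk>
      \<Longrightarrow> eval p env (Cond a b c) v (Suc (m + n))"
| eval_Cond_False:
    "\<lbrakk>eval p env a (IntD 0) m; eval p env c v n\<rbrakk> \<Longrightarrow> eval p env (Cond a b c) v (Suc (m + n))"
| eval_Bind:
    "\<lbrakk>eval p env a x m; eval p (x # env) b v n\<rbrakk> \<Longrightarrow> eval p env (Bind a b) v (Suc (m + n))"
| eval_Call:
    "\<lbrakk>eval p env a x m; i < length p; eval p [x] (p ! i) v n\<rbrakk>
      \<Longrightarrow> eval p env (Call i a) v (Suc (m + n))"

inductive_cases eval_VarE: "eval p env (Var i) v n"
inductive_cases eval_ConstE: "eval p env (Const k) v n"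
inductive_cases eval_ArithE: "eval p env (Arith f a b) v n"
inductive_cases eval_MkPairE: "eval p env (MkPair a b) v n"
inductive_cases eval_FstE: "eval p env (Fst a) v n"
inductive_cases eval_SndE: "eval p env (Snd a) v n"
inductive_cases eval_IsPairE: "eval p env (IsPair a) v n"
inductive_cases eval_CondE: "eval p env (Cond a b c) v n"
inductive_cases eval_BindE: "eval p env (Bind a b) v n"
inductive_cases eval_CallE: "eval p env (Call i a) v n"

lemma eval_deterministic:
  assumes "eval p env a v n" and "eval p env a v' n'"
  shows "v = v' \<and> n = n'"
  using assms
proof (induction arbitrary: v' n' rule: eval.induct)
  case eval_Var then show ?case by (auto elim: eval_VarE)
next
  case eval_Const then show ?case by (auto elim: eval_ConstE)
next
  case eval_Arith
  from eval_Arith.prems show ?case by (rule eval_ArithE) (use eval_Arith.IH in blast)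
next
  case eval_MkPair
  from eval_MkPair.prems show ?case by (rule eval_MkPairE) (use eval_MkPair.IH in blast)
next
  case eval_Fst
  from eval_Fst.prems show ?case by (rule eval_FstE) (use eval_Fst.IH in blast)
next
  case eval_Snd
  from eval_Snd.prems show ?case by (rule eval_SndE) (use eval_Snd.IH in blast)
next
  case eval_IsPair_PairD
  from eval_IsPair_PairD.prems show ?case
    by (rule eval_IsPairE) (use eval_IsPair_PairD.IH in blast)+
next
  case eval_IsPair_IntD
  from eval_IsPair_IntD.prems show ?case
    by (rule eval_IsPairE) (use eval_IsPair_IntD.IH in blast)+
next
  case eval_Cond_True
  from eval_Cond_True.prems show ?case
    by (rule eval_CondE) (use eval_Cond_True.IH eval_Cond_True.hyps in blast)+
next
  case eval_Cond_False
  from eval_Cond_False.prems show ?case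
    by (rule eval_CondE) (use eval_Cond_False.IH in blast)+
next
  case eval_Bind
  from eval_Bind.prems show ?case by (rule eval_BindE) (use eval_Bind.IH in blast)
next
  case eval_Call
  from eval_Call.prems show ?case by (rule eval_CallE) (use eval_Call.IH in blast)
qed

definition polynomial_time_solvable ::
  "'i set \<Rightarrow> ('i \<Rightarrow> data) \<Rightarrow> ('i \<Rightarrow> data \<Rightarrow> bool) \<Rightarrow> bool" where
  "polynomial_time_solvable instances encode correct \<longleftrightarrow>
     (\<exists>(p :: program) (q :: nat poly). \<forall>x\<in>instances. \<exists>v n.
        eval p [encode x] (Call 0 (Var 0)) v n \<and>
        n \<le> poly q (data_size (encode x)) \<and> correct x v)"

section \<open>Encoding of instances and solutions\<close>

fun list_data :: "data list \<Rightarrow> data" where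
  "list_data [] = IntD 0"
| "list_data (x # xs) = PairD x (list_data xs)"

abbreviation nat_data :: "nat \<Rightarrow> data" where
  "nat_data n \<equiv> IntD (int n)"

definition rat_data :: "rat \<Rightarrow> data" where
  "rat_data r = (case quotient_of r of (a, b) \<Rightarrow> PairD (IntD a) (IntD b))"

type_synonym sp_instance =
  "(nat, nat) pre_digraph \<times> nat \<times> nat \<times> (nat \<Rightarrow> rat) \<times> (nat \<Rightarrow> rat)"

text \<open>Nodes and arcs are numbered consecutively from 0; weights are rational, so that they have a
  finite description.\<close>

definition sp_instances :: "sp_instance set" where
  "sp_instances = {(G, s, t, c, d).
     series_parallel G s t \<and> verts G = {..<card (verts G)} \<and> arcs G = {..<card (arcs G)} \<and>
     (\<forall>e\<in>arcs G. 0 \<le> c e \<and> 0 \<le> d e)}"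

definition encode_instance :: "sp_instance \<Rightarrow> data" where
  "encode_instance = (\<lambda>(G, s, t, c, d).
     list_data [nat_data (card (verts G)), nat_data s, nat_data t,
       list_data (map (\<lambda>e. list_data
           [nat_data (tail G e), nat_data (head G e), rat_data (c e), rat_data (d e)])
         [0..<card (arcs G)])])"

definition encodes_solution :: "sp_instance \<Rightarrow> data \<Rightarrow> bool" where
  "encodes_solution = (\<lambda>(G, s, t, c, d) v.
     \<exists>Ps. distinct Ps \<and> v = list_data (map (\<lambda>P. list_data (map nat_data P)) Ps) \<and>
       variable_sized_solution G s t (\<lambda>e. of_rat (c e)) (interval_box G (\<lambda>e. of_rat (d e))) (set Ps))"

end

theory Submission
  imports Defs
begin

text \<open>
  A cost vector is a vertex of the upper image only if it is optimal for two different weightings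
  \<open>c + \<lambda> d\<close>; these vectors are the pieces of the lower envelope of the lines \<open>\<lambda> \<mapsto> c(P) + \<lambda> d(P)\<close>.
  A parallel composition takes the union of the cost vectors of the components, so envelope sizes
  add up; a series composition takes the Minkowski sum, whose envelope has at most one piece less
  than both envelopes together. Since \<open>M - N + 2\<close> is additive for parallel compositions and drops by
  one for series compositions, induction gives the bound. A weaker bound \<open>M\<close> holds for the paths
  from any node to \<open>t\<close>.

  The worst case of a path over the box of size \<open>\<lambda>\<close> is \<open>c(P) + \<lambda> d(P)\<close>, so a smallest solution of
  the robust problem picks one path for each piece of the envelope. It is found by a dynamic program
  that labels the nodes backwards from \<open>t\<close> with one path for each piece of the envelope at the node;
  by the bound the labels stay polynomially large.
\<close>

section \<open>Lower envelopes of finite planar sets\<close>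

text \<open>The condition \<open>supported\<close> links the sides of the argument: vertices of the
  upper image satisfy it, it is equivalent to membership in the envelope, and it is a polynomial
  inequality in the costs, so a machine without division can test it on fractions. The dynamic
  program is not given a series-parallel decomposition. It meets arbitrary intermediate nodes, which
  is why the induction over the graph also bounds the envelopes there. Polynomial time has two more
  obstacles. Denominators are multiplied when weights are added; but a label stores its path rather
  than its cost, and a cost recomputed from a path has no more bits than the size of the list of its
  weights. Shared pairs can represent data exponentially larger than the time spent on them, so
  every loop carries a bound on the size of its states; acyclicity provides it for labels, since a
  path repeats no arc and its encoding is no larger than that of the arc list.\<close>

definition lin :: "real \<Rightarrow> real \<times> real \<Rightarrow> real" where
  "lin l a = fst a + l * snd a"

definition minimizer :: "(real \<times> real) set \<Rightarrow> real \<Rightarrow> real \<times> real \<Rightarrow> bool" where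
  "minimizer A l a \<longleftrightarrow> a \<in> A \<and> (\<forall>b\<in>A. lin l a \<le> lin l b)"

text \<open>Asking for two weights instead of a unique minimizer makes perturbation arguments unnecessary.\<close>

definition envelope :: "(real \<times> real) set \<Rightarrow> (real \<times> real) set" where
  "envelope A = {a. \<exists>l1 l2. 0 \<le> l1 \<and> l1 < l2 \<and> minimizer A l1 a \<and> minimizer A l2 a}"

definition covers :: "(real \<times> real) set \<Rightarrow> (real \<times> real) set \<Rightarrow> bool" where
  "covers A C \<longleftrightarrow> C \<subseteq> A \<and> (\<forall>l\<ge>0. \<exists>a\<in>C. minimizer A l a)"

text \<open>Weight-free membership in the envelope. The second conjunct compares slopes: for
  \<open>a\<close> to win, \<open>b\<close> demands a weight of at least
  \<open>(fst a - fst b) / (snd b - snd a)\<close>, and \<open>b'\<close> allows at most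
  \<open>(fst b' - fst a) / (snd a - snd b')\<close>. Once dominating points are excluded both
  denominators are positive, and cross-multiplication gives the product form.\<close>

definition supported :: "(real \<times> real) set \<Rightarrow> real \<times> real \<Rightarrow> bool" where
  "supported A a \<longleftrightarrow>
     (\<forall>b\<in>A. fst b \<le> fst a \<longrightarrow> snd b \<le> snd a \<longrightarrow> b = a) \<and>
     (\<forall>b\<in>A. \<forall>b'\<in>A. fst b < fst a \<longrightarrow> snd b' < snd a \<longrightarrow>
        (fst a - fst b) * (snd a - snd b') < (fst b' - fst a) * (snd b - snd a))"

section \<open>Covering sets and minimality of the envelope\<close>

lemma envelopeI: "0 \<le> l1 \<Longrightarrow> l1 < l2 \<Longrightarrow> minimizer A l1 a \<Longrightarrow> minimizer A l2 a \<Longrightarrow> a \<in> envelope A"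
  by (auto simp: envelope_def)

lemma lin_add: "lin l (a + b) = lin l a + lin l b"
  by (simp add: lin_def algebra_simps)

lemma envelope_subset: "envelope A \<subseteq> A"
  by (auto simp: envelope_def minimizer_def)

lemma lin_eq_at_two:
  assumes "lin l1 a = lin l1 b" "lin l2 a = lin l2 b" "l1 \<noteq> l2"
  shows "a = b"
proof -
  have "(l1 - l2) * (snd a - snd b) = 0"
    using assms(1,2) by (simp add: lin_def algebra_simps)
  then have "snd a = snd b" using assms(3) by simp
  with assms(1) show ?thesis by (simp add: lin_def prod_eq_iff)
qed

text \<open>Among the minimizers at \<open>l\<close>, the one with the smallest second coordinate
  remains optimal for slightly larger weights. Moving only to the right stays within the nonnegative
  weights, even from \<open>l = 0\<close>.\<close>

lemma envelope_covers:
  assumes "finite A" "A \<noteq> {}"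
  shows "covers A (envelope A)"
proof -
  have "\<exists>a\<in>envelope A. minimizer A l a" if l: "l \<ge> 0" for l
  proof -
    define M where "M = {a. minimizer A l a}"
    have "M \<subseteq> A" by (auto simp: M_def minimizer_def)
    then have fM: "finite M" using assms(1) finite_subset by blast
    have "is_arg_min (lin l) (\<lambda>a. a \<in> A) (arg_min_on (lin l) A)"
      using assms arg_min_if_finite(1,2)[of A "lin l"] by (auto simp: is_arg_min_def)
    then have "arg_min_on (lin l) A \<in> M"
      by (auto simp: M_def minimizer_def is_arg_min_def not_less)
    then have "M \<noteq> {}" by blast
    define a where "a = arg_min_on snd M"
    have aM: "a \<in> M" and amin: "\<And>b. b \<in> M \<Longrightarrow> snd a \<le> snd b"
      using arg_min_if_finite[OF fM \<open>M \<noteq> {}\<close>, of snd] by (auto simp: a_def not_less)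
    have aA: "a \<in> A" and amn: "\<And>b. b \<in> A \<Longrightarrow> lin l a \<le> lin l b"
      using aM by (auto simp: M_def minimizer_def)
    define B where "B = {b\<in>A. snd b < snd a}"
    \<comment> \<open>The line of \<open>b\<close> draws level with that of \<open>a\<close> once
      the weight has grown by \<open>g b\<close>; only points with a smaller second coordinate ever
      catch up.\<close>
    define g where "g b = (lin l b - lin l a) / (snd a - snd b)" for b
    have gpos: "g b > 0" if "b \<in> B" for b
    proof -
      have "b \<notin> M" using that amin unfolding B_def by fastforce
      moreover have "b \<in> A" using that by (simp add: B_def)
      ultimately have "\<not> lin l b \<le> lin l a"
        unfolding M_def minimizer_def using amn order_trans by blast
      then have "lin l a < lin l b" by simp
      with that show ?thesis by (simp add: g_def B_def)
    qed
    have fB: "finite B" using assms(1) by (simp add: B_def)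
    \<comment> \<open>The entry 1 supplies a value when no point catches up.\<close>
    define e where "e = Min (insert 1 (g ` B))"
    have e0: "e > 0" using fB gpos by (auto simp: e_def)
    have eg: "e \<le> g b" if "b \<in> B" for b using fB that by (auto simp: e_def)
    have "minimizer A (l + e) a"
    proof -
      have "lin (l + e) a \<le> lin (l + e) b" if b: "b \<in> A" for b
      proof (cases "snd b < snd a")
        case True
        then have "b \<in> B" using b by (simp add: B_def)
        have "e * (snd a - snd b) \<le> lin l b - lin l a"
          using eg[OF \<open>b \<in> B\<close>] True by (simp add: g_def pos_le_divide_eq)
        then show ?thesis by (simp add: lin_def algebra_simps)
      next
        case False
        then have "e * snd a \<le> e * snd b" using e0 by simp
        then show ?thesis using amn[OF b] by (simp add: lin_def algebra_simps)
      qed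
      then show ?thesis using aA by (simp add: minimizer_def)
    qed
    moreover have "minimizer A l a" using aM by (simp add: M_def)
    ultimately have "a \<in> envelope A" using l e0
      by (auto intro: envelopeI[of l "l + e"])
    then show ?thesis using \<open>minimizer A l a\<close> by blast
  qed
  then show ?thesis using envelope_subset by (auto simp: covers_def)
qed

lemma covers_minimizer:
  assumes "covers A C" "l \<ge> 0"
  shows "minimizer C l a \<longleftrightarrow> a \<in> C \<and> minimizer A l a"
  using assms unfolding covers_def minimizer_def by (blast intro: order_trans)

text \<open>The lower bound for every covering set. At the midpoint of the two weights of
  \<open>a\<close>, some \<open>c\<close> in \<open>C\<close> is at least as good as
  \<open>a\<close>, but it is better at neither end; since \<open>lin\<close> is affine in the
  weight, they tie at both ends and coincide.\<close>

lemma envelope_subset_covers: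
  assumes "covers A C"
  shows "envelope A \<subseteq> C"
proof
  fix a assume "a \<in> envelope A"
  then obtain l1 l2 where l: "0 \<le> l1" "l1 < l2" "minimizer A l1 a" "minimizer A l2 a"
    by (auto simp: envelope_def)
  define m where "m = (l1 + l2) / 2"
  have "m \<ge> 0" using l by (simp add: m_def)
  with assms obtain c where c: "c \<in> C" "minimizer A m c" by (auto simp: covers_def)
  have "lin m c \<le> lin m a" "lin l1 a \<le> lin l1 c" "lin l2 a \<le> lin l2 c"
    using c l by (auto simp: minimizer_def)
  moreover have "lin m x = (lin l1 x + lin l2 x) / 2" for x
    by (simp add: m_def lin_def field_simps)
  ultimately have "lin l1 a = lin l1 c" "lin l2 a = lin l2 c" by simp_all
  then have "a = c" using l lin_eq_at_two[of l1 a c l2] by simp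
  then show "a \<in> C" using c by simp
qed

text \<open>Justifies pruning: candidates that retain an optimal point for each weight determine the
  envelope of all points, so discarded continuations need never be reconsidered.\<close>

lemma envelope_covers_eq:
  assumes "covers A C"
  shows "envelope C = envelope A"
proof -
  have "minimizer C l1 a \<and> minimizer C l2 a \<longleftrightarrow> a \<in> C \<and> minimizer A l1 a \<and> minimizer A l2 a"
    if "0 \<le> l1" "l1 < l2" for a l1 l2
    using covers_minimizer[OF assms] that by auto
  then have "a \<in> envelope C \<longleftrightarrow> a \<in> C \<and> a \<in> envelope A" for a
    unfolding envelope_def by blast
  then show ?thesis using envelope_subset_covers[OF assms] by auto
qed

section \<open>Envelopes of unions and Minkowski sums\<close>

lemma card_envelope_Un:
  assumes "finite A" "finite B"
  shows "card (envelope (A \<union> B)) \<le> card (envelope A) + card (envelope B)"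
proof -
  have "envelope (A \<union> B) \<subseteq> envelope A \<union> envelope B"
    unfolding envelope_def minimizer_def by blast
  moreover have "finite (envelope A \<union> envelope B)"
    using assms envelope_subset finite_subset by (metis finite_UnI)
  ultimately show ?thesis by (meson card_Un_le card_mono order_trans)
qed

lemma minimizer_antimono:
  assumes "minimizer A l a" "minimizer A l' a'" "l < l'"
  shows "snd a' \<le> snd a"
proof -
  have "lin l a \<le> lin l a'" "lin l' a' \<le> lin l' a" using assms by (auto simp: minimizer_def)
  then have "(l' - l) * snd a' \<le> (l' - l) * snd a" by (simp add: lin_def algebra_simps)
  then show ?thesis using assms(3) by simp
qed

text \<open>Sorted by the second coordinate, the envelope of a sum is a chain in the product of the
  envelopes of the summands.\<close>

lemma card_envelope_sum:
  assumes "finite A" "finite B" "A \<noteq> {}" "B \<noteq> {}"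
  defines "S \<equiv> {a + b | a b. a \<in> A \<and> b \<in> B}"
  shows "card (envelope S) + 1 \<le> card (envelope A) + card (envelope B)"
proof -
  define dec where "dec x p l1 l2 \<longleftrightarrow> x = fst p + snd p \<and> 0 \<le> l1 \<and> l1 < l2 \<and>
     minimizer A l1 (fst p) \<and> minimizer A l2 (fst p) \<and>
     minimizer B l1 (snd p) \<and> minimizer B l2 (snd p)" for x p l1 l2
  have "\<exists>p l1 l2. dec x p l1 l2" if "x \<in> envelope S" for x
  proof -
    obtain l1 l2 where l: "0 \<le> l1" "l1 < l2" "minimizer S l1 x" "minimizer S l2 x"
      using \<open>x \<in> envelope S\<close> by (auto simp: envelope_def)
    then obtain a b where ab: "x = a + b" "a \<in> A" "b \<in> B" by (auto simp: minimizer_def S_def)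
    \<comment> \<open>Exchanging one summand while keeping the other shows that both are optimal for
      every weight for which their sum is.\<close>
    have "minimizer A l a \<and> minimizer B l b" if "minimizer S l x" for l
    proof -
      have *: "lin l (a + b) \<le> lin l (a' + b')" if "a' \<in> A" "b' \<in> B" for a' b'
      proof -
        have "a' + b' \<in> S" unfolding S_def using that by blast
        then show ?thesis using \<open>minimizer S l x\<close> ab(1) by (auto simp: minimizer_def)
      qed
      have "lin l a \<le> lin l a'" if "a' \<in> A" for a' using *[OF that ab(3)] by (simp add: lin_add)
      moreover have "lin l b \<le> lin l b'" if "b' \<in> B" for b'
        using *[OF ab(2) that] by (simp add: lin_add)
      ultimately show ?thesis using ab by (simp add: minimizer_def)
    qed
    with l ab have "dec x (a, b) l1 l2" by (simp add: dec_def)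
    then show ?thesis by blast
  qed
  then obtain p where p: "\<And>x. x \<in> envelope S \<Longrightarrow> \<exists>l1 l2. dec x (p x) l1 l2" by metis
  \<comment> \<open>Position of \<open>a\<close>, counted from 0, when the envelope is listed by
    decreasing second coordinate.\<close>
  define ra where "ra X a = card {a' \<in> envelope X. snd a < snd a'}" for X and a :: "real \<times> real"
  have fE: "finite (envelope A)" "finite (envelope B)"
    using assms envelope_subset finite_subset by metis+
  have inE: "fst (p x) \<in> envelope A" "snd (p x) \<in> envelope B" if "x \<in> envelope S" for x
    using p[OF that] by (auto simp: dec_def envelope_def)
  have ra_mono: "ra X a \<le> ra X b" if "finite (envelope X)" "snd b \<le> snd a" for X a b
    unfolding ra_def by (rule card_mono) (use that in auto)
  have ra_strict: "ra X a < ra X b" if "finite (envelope X)" "snd b < snd a" "a \<in> envelope X" for X a b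
    unfolding ra_def by (rule psubset_card_mono) (use that in \<open>auto simp: psubset_eq\<close>)
  have ra_less: "ra X a < card (envelope X)" if "finite (envelope X)" "a \<in> envelope X" for X a
    unfolding ra_def by (rule psubset_card_mono) (use that in auto)
  define f where "f x = ra A (fst (p x)) + ra B (snd (p x))" for x
  \<comment> \<open>Towards smaller second coordinates neither summand moves back in its envelope,
    and at least one moves forward.\<close>
  have step: "f x < f y" if xy: "x \<in> envelope S" "y \<in> envelope S" "snd y < snd x" for x y
  proof -
    obtain l1 l2 where d: "dec x (p x) l1 l2" using p xy by blast
    obtain k1 k2 where e: "dec y (p y) k1 k2" using p xy by blast
    have "x = fst (p x) + snd (p x)" "y = fst (p y) + snd (p y)"
      using d e unfolding dec_def by blast+
    then have sx: "snd x = snd (fst (p x)) + snd (snd (p x))"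
      and sy: "snd y = snd (fst (p y)) + snd (snd (p y))"
      using snd_add by metis+
    have mono: "snd (fst (p y)) \<le> snd (fst (p x)) \<and> snd (snd (p y)) \<le> snd (snd (p x))" if "l1 < k2"
      using d e that minimizer_antimono unfolding dec_def by meson
    \<comment> \<open>Otherwise the weights of \<open>y\<close> all precede those of
      \<open>x\<close>, and both summands of \<open>y\<close> would have second coordinates at least
      as large as those of \<open>x\<close>.\<close>
    have "l1 < k2"
    proof (rule ccontr)
      assume "\<not> l1 < k2"
      then have "k1 < l1" using e unfolding dec_def by simp
      then have "snd (fst (p x)) \<le> snd (fst (p y)) \<and> snd (snd (p x)) \<le> snd (snd (p y))"
        using d e minimizer_antimono unfolding dec_def by meson
      then show False using xy(3) sx sy by simp
    qed
    note m = mono[OF this]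
    have "snd (fst (p y)) < snd (fst (p x)) \<or> snd (snd (p y)) < snd (snd (p x))"
    proof (rule ccontr)
      assume "\<not> ?thesis"
      then show False using xy(3) sx sy by simp
    qed
    then show ?thesis
      unfolding f_def using m ra_mono[OF fE(1)] ra_mono[OF fE(2)]
        ra_strict[OF fE(1) _ inE(1)[OF xy(1)]] ra_strict[OF fE(2) _ inE(2)[OF xy(1)]]
      by (meson add_le_less_mono add_less_le_mono)
  qed
  have snd_inj: "x = y" if xy: "x \<in> envelope S" "y \<in> envelope S" "snd x = snd y" for x y
  proof -
    obtain l k where "minimizer S l x" "minimizer S k y"
      using xy by (auto simp: envelope_def)
    then have "lin l x \<le> lin l y" "lin k y \<le> lin k x" using xy by (auto simp: minimizer_def)
    then show ?thesis using xy(3) by (simp add: lin_def prod_eq_iff)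
  qed
  have "inj_on f (envelope S)"
  proof (rule inj_onI)
    fix x y assume "x \<in> envelope S" "y \<in> envelope S" "f x = f y"
    then show "x = y" using step[of x y] step[of y x] snd_inj[of x y] by fastforce
  qed
  \<comment> \<open>Each position is at most one less than the size of its envelope, so their sum
    takes at most \<open>card (envelope A) + card (envelope B) - 1\<close> values; this is the piece
    lost in a series composition.\<close>
  moreover have "f ` envelope S \<subseteq> {..<card (envelope A) + card (envelope B) - 1}"
  proof
    fix i assume "i \<in> f ` envelope S"
    then obtain x where x: "x \<in> envelope S" "i = f x" by blast
    show "i \<in> {..<card (envelope A) + card (envelope B) - 1}"
      using ra_less[OF fE(1) inE(1)[OF x(1)]] ra_less[OF fE(2) inE(2)[OF x(1)]] x
      by (auto simp: f_def)
  qed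
  ultimately have "card (envelope S) \<le> card (envelope A) + card (envelope B) - 1"
    using card_inj_on_le[of f _ "{..<card (envelope A) + card (envelope B) - 1}"] by simp
  moreover have "envelope A \<noteq> {}"
    using envelope_covers[OF assms(1,3)] by (auto simp: covers_def)
  then have "card (envelope A) > 0" using fE(1) by (simp add: card_gt_0_iff)
  ultimately show ?thesis by linarith
qed

text \<open>\<open>lo b\<close> and \<open>up b\<close> are the weights at which the lines of
  \<open>a\<close> and \<open>b\<close> cross. Points with a smaller first coordinate bound the
  weights admissible for \<open>a\<close> from below, points with a smaller second coordinate from
  above; \<open>supported\<close> keeps every lower bound strictly below every upper bound, so an
  interval of positive length is left.\<close>

lemma envelope_iff_supported:
  assumes "finite A" "a \<in> A"
  shows "a \<in> envelope A \<longleftrightarrow> supported A a"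
proof
  assume "a \<in> envelope A"
  then obtain l1 l2 where l: "0 \<le> l1" "l1 < l2" "minimizer A l1 a" "minimizer A l2 a"
    by (auto simp: envelope_def)
  have m1: "lin l1 a \<le> lin l1 b" and m2: "lin l2 a \<le> lin l2 b" if "b \<in> A" for b
    using l that by (auto simp: minimizer_def)
  show "supported A a"
    unfolding supported_def
  proof (intro conjI ballI impI)
    fix b assume b: "b \<in> A" "fst b \<le> fst a" "snd b \<le> snd a"
    have "l2 * snd b \<le> l2 * snd a" using l b by (simp add: mult_left_mono)
    with m2[OF b(1)] b have e: "fst a = fst b" "l2 * snd a = l2 * snd b"
      unfolding lin_def by linarith+
    then have "snd a = snd b" using l by simp
    with e show "b = a" by (simp add: prod_eq_iff)
  next
    fix b b' assume b: "b \<in> A" "b' \<in> A" "fst b < fst a" "snd b' < snd a"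
    have 1: "fst a - fst b \<le> l1 * (snd b - snd a)"
      using m1[OF b(1)] by (simp add: lin_def algebra_simps)
    have 2: "l2 * (snd a - snd b') \<le> fst b' - fst a"
      using m2[OF b(2)] by (simp add: lin_def algebra_simps)
    have pos: "snd b - snd a > 0" using 1 b l
      by (smt (verit, best) mult_nonneg_nonpos)
    have "(fst a - fst b) * (snd a - snd b') \<le> l1 * (snd b - snd a) * (snd a - snd b')"
      using 1 b by (simp add: mult_right_mono)
    also have "\<dots> < l2 * (snd b - snd a) * (snd a - snd b')"
      using pos b l by (simp add: mult_strict_right_mono)
    also have "\<dots> \<le> (fst b' - fst a) * (snd b - snd a)"
      using mult_right_mono[OF 2, of "snd b - snd a"] pos by (simp add: algebra_simps)
    finally show "(fst a - fst b) * (snd a - snd b') < (fst b' - fst a) * (snd b - snd a)" .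
  qed
next
  assume s: "supported A a"
  have dom: "b = a" if "b \<in> A" "fst b \<le> fst a" "snd b \<le> snd a" for b
    using s that by (simp add: supported_def)
  define lo where "lo b = (fst a - fst b) / (snd b - snd a)" for b
  define up where "up b = (fst b - fst a) / (snd a - snd b)" for b
  define Lo where "Lo = {b \<in> A. fst b < fst a}"
  define Up where "Up = {b \<in> A. snd b < snd a}"
  have fin: "finite Lo" "finite Up" using assms by (auto simp: Lo_def Up_def)
  have Lo2: "snd a < snd b" if "b \<in> Lo" for b using that dom[of b] by (force simp: Lo_def)
  have Up1: "fst a < fst b" if "b \<in> Up" for b using that dom[of b] by (force simp: Up_def)
  have lu: "lo b < up b'" if "b \<in> Lo" "b' \<in> Up" for b b'
  proof -
    have "(fst a - fst b) * (snd a - snd b') < (fst b' - fst a) * (snd b - snd a)"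
      using s that by (simp add: supported_def Lo_def Up_def)
    then show ?thesis using Lo2[OF that(1)] that(2)
      by (simp add: lo_def up_def Up_def divide_simps mult.commute)
  qed
  have up0: "0 < up b'" if "b' \<in> Up" for b'
    using that Up1[OF that] by (simp add: up_def Up_def)
  \<comment> \<open>The entry 0 accounts for the nonnegativity of weights; in \<open>l2\<close>, the
    entry \<open>l1 + 1\<close> supplies an endpoint when nothing bounds the weight from
    above.\<close>
  define l1 where "l1 = Max (insert 0 (lo ` Lo))"
  have l1: "l1 \<ge> 0" "\<And>b. b \<in> Lo \<Longrightarrow> lo b \<le> l1" using fin by (auto simp: l1_def)
  have l1u: "l1 < up b'" if "b' \<in> Up" for b'
    using fin lu that up0 by (auto simp: l1_def)
  define l2 where "l2 = Min (insert (l1 + 1) (up ` Up))"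
  have l2: "l1 < l2" "\<And>b. b \<in> Up \<Longrightarrow> l2 \<le> up b" using fin l1u by (auto simp: l2_def)
  have mm: "minimizer A l a" if l: "l1 \<le> l" "l \<le> l2" for l
  proof -
    have "lin l a \<le> lin l b" if b: "b \<in> A" for b
    proof -
      consider "b \<in> Lo" | "b \<in> Up" | "fst a \<le> fst b" "snd a \<le> snd b"
        using b by (force simp: Lo_def Up_def)
      then show ?thesis
      proof cases
        case 1
        then have "lo b \<le> l" using l1 l by fastforce
        then have "fst a - fst b \<le> l * (snd b - snd a)"
          using Lo2[OF 1] by (simp add: lo_def pos_divide_le_eq)
        then show ?thesis by (simp add: lin_def algebra_simps)
      next
        case 2
        then have "l \<le> up b" using l2 l by fastforce
        then have "l * (snd a - snd b) \<le> fst b - fst a"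
          using 2 by (simp add: up_def Up_def pos_le_divide_eq)
        then show ?thesis by (simp add: lin_def algebra_simps)
      next
        case 3
        then have "l * snd a \<le> l * snd b" using l l1 by (simp add: mult_left_mono)
        then show ?thesis using 3 by (simp add: lin_def)
      qed
    qed
    then show ?thesis using assms by (simp add: minimizer_def)
  qed
  then show "a \<in> envelope A"
    using l1(1) l2(1) mm[of l1] mm[of l2] by (auto intro: envelopeI)
qed

text \<open>Either failure of \<open>supported\<close> puts \<open>a\<close> inside a segment of the
  upper image. A dominating point can be reflected at \<open>a\<close>, since the upper image is
  closed upwards. If the segment from \<open>b\<close> to \<open>b'\<close> does not pass above
  \<open>a\<close>, its point with the first coordinate of \<open>a\<close> dominates
  \<open>a\<close>, hence equals \<open>a\<close>.\<close>

lemma extreme_point_supported: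
  assumes ext: "a extreme_point_of {v + r | v r. v \<in> convex hull A \<and> 0 \<le> fst r \<and> 0 \<le> snd r}"
      (is "a extreme_point_of ?V")
  shows "supported A a"
proof -
  have inV: "v + r \<in> ?V" if "v \<in> convex hull A" "0 \<le> fst r" "0 \<le> snd r" for v r :: "real \<times> real"
    using that by blast
  have above: "v = a" if "v \<in> convex hull A" "fst v \<le> fst a" "snd v \<le> snd a" for v
  proof (rule ccontr)
    assume ne: "v \<noteq> a"
    have "v \<in> ?V" using inV[OF that(1), of 0] by simp
    moreover have "v + 2 *\<^sub>R (a - v) \<in> ?V" by (rule inV) (use that in auto)
    moreover have "a \<in> open_segment v (v + 2 *\<^sub>R (a - v))"
      using ne by (auto simp: in_segment prod_eq_iff algebra_simps intro!: exI[of _ "1/2"])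
    ultimately show False using ext unfolding extreme_point_of_def by blast
  qed
  show ?thesis
    unfolding supported_def
  proof (intro conjI ballI impI)
    fix b assume "b \<in> A" "fst b \<le> fst a" "snd b \<le> snd a"
    then show "b = a" using above hull_inc by metis
  next
    fix b b' assume b: "b \<in> A" "b' \<in> A" "fst b < fst a" "snd b' < snd a"
    have b2: "snd a < snd b" using above[of b] b hull_inc[of b A] by fastforce
    have b1: "fst a < fst b'" using above[of b'] b hull_inc[of b' A] by fastforce
    show "(fst a - fst b) * (snd a - snd b') < (fst b' - fst a) * (snd b - snd a)"
    proof (rule ccontr)
      assume "\<not> ?thesis"
      then have ge: "(fst b' - fst a) * (snd b - snd a) \<le> (fst a - fst b) * (snd a - snd b')" by simp
      define D where "D = fst b' - fst b"
      have D: "D > 0" using b b1 by (simp add: D_def)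
      \<comment> \<open>Chosen such that \<open>v\<close> has the same first coordinate as
        \<open>a\<close>.\<close>
      define u where "u = (fst a - fst b) / D"
      have u: "0 < u" "u < 1" using b b1 D by (auto simp: u_def D_def)
      define v where "v = (1 - u) *\<^sub>R b + u *\<^sub>R b'"
      have vh: "v \<in> convex hull A"
        unfolding v_def by (rule convexD_alt[OF convex_convex_hull]) (use b u in \<open>auto simp: hull_inc\<close>)
      have uD: "u * D = fst a - fst b" using D by (simp add: u_def)
      have v1: "fst v = fst a"
        using uD by (simp add: v_def D_def algebra_simps)
      have "D * (snd v - snd a) = (fst b' - fst a) * (snd b - snd a) - (fst a - fst b) * (snd a - snd b')"
      proof -
        have "D * (snd v - snd a) = D * (snd b - snd a) + (u * D) * (snd b' - snd b)"
          by (simp add: v_def algebra_simps)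
        also have "\<dots> = (fst b' - fst a) * (snd b - snd a) - (fst a - fst b) * (snd a - snd b')"
          unfolding uD by (simp add: D_def algebra_simps)
        finally show ?thesis .
      qed
      then have "D * (snd v - snd a) \<le> 0" using ge by simp
      then have "snd v \<le> snd a" using D by (simp add: mult_le_0_iff)
      then have va: "v = a" using above[OF vh] v1 by simp
      have "b \<in> ?V" "b' \<in> ?V" using inV[of b 0] inV[of b' 0] b hull_inc[of _ A] by auto
      moreover have "a \<in> open_segment b b'"
        unfolding in_segment using va u b b1 by (auto simp: v_def intro!: exI[of _ u])
      ultimately show False using ext unfolding extreme_point_of_def by blast
    qed
  qed
qed

section \<open>Walks in series-parallel graphs\<close>

text \<open>The properties that both compositions preserve. Fixing the potential to 0 at
  \<open>s\<close> and 1 at \<open>t\<close> lets the potentials of components be glued; strict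
  growth gives acyclicity, and the range forbids arcs into \<open>s\<close> and out of
  \<open>t\<close>.\<close>

locale st_dag = fin_digraph G for G :: "('a, 'b) pre_digraph" +
  fixes s t :: 'a
  assumes s_in_verts: "s \<in> verts G" and t_in_verts: "t \<in> verts G"
    and out_arc: "v \<in> verts G \<Longrightarrow> v \<noteq> t \<Longrightarrow> \<exists>e\<in>arcs G. tail G e = v"
    and ex_potential: "\<exists>pot :: 'a \<Rightarrow> real. pot s = 0 \<and> pot t = 1 \<and>
      (\<forall>v\<in>verts G. 0 \<le> pot v \<and> pot v \<le> 1) \<and> (\<forall>e\<in>arcs G. pot (tail G e) < pot (head G e))"
begin

lemma s_neq_t: "s \<noteq> t"
  using ex_potential by force

lemma tail_neq_t: "e \<in> arcs G \<Longrightarrow> tail G e \<noteq> t"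
  using ex_potential head_in_verts by fastforce

lemma head_neq_s: "e \<in> arcs G \<Longrightarrow> head G e \<noteq> s"
  using ex_potential tail_in_verts by fastforce

text \<open>The potential forbids returning to a node. Walks, which unfold arc by arc, can therefore
  stand for paths.\<close>

lemma awalk_imp_apath: "awalk u p v \<Longrightarrow> apath u p v"
proof -
  obtain pot :: "'a \<Rightarrow> real" where pot: "\<And>e. e \<in> arcs G \<Longrightarrow> pot (tail G e) < pot (head G e)"
    using ex_potential by blast
  have "distinct (awalk_verts u p) \<and> (\<forall>w\<in>set (awalk_verts u p). pot u \<le> pot w)" if "awalk u p v"
    using that
  proof (induction p arbitrary: u)
    case (Cons e p)
    then have e: "e \<in> arcs G" "u = tail G e" "awalk (head G e) p v" by (auto simp: awalk_Cons_iff)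
    from Cons.IH[OF e(3)] pot[OF e(1)] e(2) show ?case by force
  qed simp
  then show "awalk u p v \<Longrightarrow> apath u p v" by (simp add: apath_def)
qed

lemma apath_iff_awalk: "apath u p v \<longleftrightarrow> awalk u p v"
  using awalk_imp_apath by (auto simp: apath_def)

lemma finite_walks: "finite {p. awalk u p v}"
  using apaths_finite[of u v] by (simp add: apath_iff_awalk)

end

section \<open>Walks in parallel and series compositions\<close>

definition walks :: "('a, 'b) pre_digraph \<Rightarrow> 'a \<Rightarrow> 'a \<Rightarrow> 'b list set" where
  "walks G u v = {p. pre_digraph.awalk G u p v}"

lemma (in st_dag) walks_eq_st_paths: "walks G s t = st_paths G s t"
  by (simp add: walks_def st_paths_def apath_iff_awalk)

text \<open>A node set that no arc leaves confines every walk started in it. For the compositions,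
  \<open>X\<close> is one component, possibly without its source.\<close>

lemma (in wf_digraph) awalk_restrict:
  assumes "wf_digraph K" "tail K = tail G" "head K = head G" "arcs K \<subseteq> arcs G" "verts K \<subseteq> verts G"
    and X: "X \<subseteq> verts K" "\<And>e. e \<in> arcs G \<Longrightarrow> tail G e \<in> X \<Longrightarrow> e \<in> arcs K \<and> head G e \<in> X"
    and "v \<in> X"
  shows "awalk v p w \<longleftrightarrow> pre_digraph.awalk K v p w"
proof -
  interpret K: wf_digraph K by fact
  show ?thesis
    using \<open>v \<in> X\<close>
  proof (induction p arbitrary: v)
    case Nil
    then show ?case using assms(5) X(1) by (auto simp: awalk_Nil_iff K.awalk_Nil_iff)
  next
    case (Cons e p)
    then show ?case
      using assms(2-4) X(2)[of e] by (auto simp: awalk_Cons_iff K.awalk_Cons_iff)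
  qed
qed

lemma union_commute: "compatible G H \<Longrightarrow> union G H = union H G"
  by (auto simp: union_def compatible_def)

lemma compatible_sym: "compatible G H \<Longrightarrow> compatible H G"
  by (simp add: compatible_def)

text \<open>Apart from \<open>s\<close>, the components meet only in \<open>t\<close>, which has no
  outgoing arcs, and nothing returns to \<open>s\<close>; so a walk stays in its component.\<close>

lemma walks_parallel_inner:
  assumes "st_dag G s t" "st_dag H s t" "compatible G H" "verts G \<inter> verts H = {s, t}"
    and "v \<in> verts G" "v \<noteq> s"
  shows "walks (union G H) v t = walks G v t"
proof -
  interpret G: st_dag G s t by fact
  interpret H: st_dag H s t by fact
  interpret U: wf_digraph "union G H"
    by (rule wellformed_union[OF G.wf_digraph_axioms H.wf_digraph_axioms assms(3)])
  have th: "tail H = tail G" "head H = head G" using assms(3) by (auto simp: compatible_def)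
  have "U.awalk v p t \<longleftrightarrow> G.awalk v p t" for p
  proof (rule U.awalk_restrict[where X = "verts G - {s}"])
    fix e assume e: "e \<in> arcs (union G H)" "tail (union G H) e \<in> verts G - {s}"
    have "e \<notin> arcs H"
    proof
      assume "e \<in> arcs H"
      then have "tail G e = t" using e(2) assms(4) H.tail_in_verts[of e] th by auto
      then show False using H.tail_neq_t[OF \<open>e \<in> arcs H\<close>] th by simp
    qed
    then show "e \<in> arcs G \<and> head (union G H) e \<in> verts G - {s}"
      using e G.head_neq_s by auto
  qed (use assms(5,6) in \<open>auto simp: G.wf_digraph_axioms\<close>)
  then show ?thesis by (simp add: walks_def)
qed

text \<open>The first arc selects the component, and the rest of the walk stays there.\<close>

lemma walks_parallel:
  assumes "st_dag G s t" "st_dag H s t" "compatible G H" "verts G \<inter> verts H = {s, t}"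
  shows "walks (union G H) s t = walks G s t \<union> walks H s t"
proof -
  interpret G: st_dag G s t by fact
  interpret H: st_dag H s t by fact
  interpret U: wf_digraph "union G H"
    by (rule wellformed_union[OF G.wf_digraph_axioms H.wf_digraph_axioms assms(3)])
  have th: "tail H = tail G" "head H = head G" using assms(3) by (auto simp: compatible_def)
  have "U.awalk s p t \<longleftrightarrow> G.awalk s p t \<or> H.awalk s p t" for p
  proof (cases p)
    case Nil
    then show ?thesis using G.s_neq_t by (auto simp: U.awalk_Nil_iff G.awalk_Nil_iff H.awalk_Nil_iff)
  next
    case (Cons e p')
    have "walks (union G H) (head G e) t = walks G (head G e) t" if "e \<in> arcs G"
      using walks_parallel_inner[OF assms] that G.head_neq_s by simp
    moreover have "walks (union G H) (head G e) t = walks H (head G e) t" if "e \<in> arcs H"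
      using walks_parallel_inner[OF assms(2,1) compatible_sym[OF assms(3)]] that
        H.head_neq_s[OF that] H.head_in_verts[OF that] th assms(4)
      by (simp add: Int_commute union_commute[OF assms(3)])
    ultimately show ?thesis
      using Cons th by (auto simp: U.awalk_Cons_iff G.awalk_Cons_iff H.awalk_Cons_iff walks_def set_eq_iff)
  qed
  then show ?thesis by (auto simp: walks_def)
qed

lemma walks_series_right:
  assumes "st_dag G s m" "st_dag H m t" "compatible G H" "verts G \<inter> verts H = {m}" "v \<in> verts H"
  shows "walks (union G H) v t = walks H v t"
proof -
  interpret G: st_dag G s m by fact
  interpret H: st_dag H m t by fact
  interpret U: wf_digraph "union G H"
    by (rule wellformed_union[OF G.wf_digraph_axioms H.wf_digraph_axioms assms(3)])
  have th: "tail H = tail G" "head H = head G" using assms(3) by (auto simp: compatible_def)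
  have "U.awalk v p t \<longleftrightarrow> H.awalk v p t" for p
  proof (rule U.awalk_restrict[where X = "verts H"])
    fix e assume e: "e \<in> arcs (union G H)" "tail (union G H) e \<in> verts H"
    have "e \<notin> arcs G"
    proof
      assume "e \<in> arcs G"
      then have "tail G e \<in> verts G \<inter> verts H" using e(2) by simp
      then show False using G.tail_neq_t[OF \<open>e \<in> arcs G\<close>] assms(4) by simp
    qed
    then show "e \<in> arcs H \<and> head (union G H) e \<in> verts H"
      using e H.head_in_verts[of e] th by auto
  qed (use assms(5) th in \<open>auto simp: H.wf_digraph_axioms\<close>)
  then show ?thesis by (simp add: walks_def)
qed

text \<open>\<open>m\<close> is the only passage from \<open>G\<close> to \<open>H\<close>, so the
  walk is cut where it arrives at \<open>m\<close>; from there on it cannot go back to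
  \<open>G\<close>.\<close>

lemma walks_series_left:
  assumes "st_dag G s m" "st_dag H m t" "compatible G H" "verts G \<inter> verts H = {m}" "v \<in> verts G"
  shows "walks (union G H) v t = {p @ q | p q. p \<in> walks G v m \<and> q \<in> walks H m t}"
proof -
  interpret G: st_dag G s m by fact
  interpret H: st_dag H m t by fact
  interpret U: wf_digraph "union G H"
    by (rule wellformed_union[OF G.wf_digraph_axioms H.wf_digraph_axioms assms(3)])
  have th: "tail H = tail G" "head H = head G" using assms(3) by (auto simp: compatible_def)
  have m: "m \<in> verts H" "m \<in> verts G" using assms(4) by auto
  have right: "U.awalk m p t \<longleftrightarrow> H.awalk m p t" for p
    using walks_series_right[OF assms(1-4) m(1)] by (auto simp: walks_def)
  have t: "t \<notin> verts G" using assms(4) H.t_in_verts H.s_neq_t by auto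
  have "\<exists>p1 p2. p = p1 @ p2 \<and> G.awalk v p1 m \<and> H.awalk m p2 t" if "U.awalk v p t" "v \<in> verts G" for p
    using that
  proof (induction p arbitrary: v)
    case Nil
    then show ?case using t by (auto simp: U.awalk_Nil_iff)
  next
    case (Cons e p)
    show ?case
    proof (cases "v = m")
      case True
      then have "H.awalk m (e # p) t" using Cons.prems(1) right by simp
      moreover have "G.awalk v [] m" using True m by (simp add: G.awalk_Nil_iff)
      ultimately show ?thesis using append_Nil by blast
    next
      case False
      have e: "e \<in> arcs G \<union> arcs H" "v = tail G e" "U.awalk (head G e) p t"
        using Cons.prems by (auto simp: U.awalk_Cons_iff)
      have eG: "e \<in> arcs G"
      proof (rule ccontr)
        assume "e \<notin> arcs G"
        then have "v \<in> verts G \<inter> verts H" using e(1,2) H.tail_in_verts[of e] th Cons.prems(2) by simp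
        then show False using False assms(4) by simp
      qed
      then obtain p1 p2 where "p = p1 @ p2" "G.awalk (head G e) p1 m" "H.awalk m p2 t"
        using Cons.IH[OF e(3)] G.head_in_verts by blast
      then have "e # p = (e # p1) @ p2 \<and> G.awalk v (e # p1) m \<and> H.awalk m p2 t"
        using eG e(2) by (simp add: G.awalk_Cons_iff)
      then show ?thesis by blast
    qed
  qed
  moreover have "U.awalk v (p1 @ p2) t" if "G.awalk v p1 m" "H.awalk m p2 t" for p1 p2
    using that(1)
  proof (induction p1 arbitrary: v)
    case Nil
    then show ?case using that(2) right by (auto simp: G.awalk_Nil_iff)
  next
    case (Cons e p1)
    then show ?case by (auto simp: G.awalk_Cons_iff U.awalk_Cons_iff)
  qed
  ultimately show ?thesis using assms(5) by (auto simp: walks_def)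
qed

section \<open>Potentials of composed graphs\<close>

lemma st_dag_parallel:
  assumes "st_dag G s t" "st_dag H s t" "compatible G H" "verts G \<inter> verts H = {s, t}"
  shows "st_dag (union G H) s t"
proof -
  interpret G: st_dag G s t by fact
  interpret H: st_dag H s t by fact
  interpret U: wf_digraph "union G H"
    by (rule wellformed_union[OF G.wf_digraph_axioms H.wf_digraph_axioms assms(3)])
  have th: "tail H = tail G" "head H = head G" using assms(3) by (auto simp: compatible_def)
  obtain f :: "'a \<Rightarrow> real" where f: "f s = 0" "f t = 1" "\<And>v. v \<in> verts G \<Longrightarrow> 0 \<le> f v \<and> f v \<le> 1"
    "\<And>e. e \<in> arcs G \<Longrightarrow> f (tail G e) < f (head G e)" using G.ex_potential by blast
  obtain g :: "'a \<Rightarrow> real" where g: "g s = 0" "g t = 1" "\<And>v. v \<in> verts H \<Longrightarrow> 0 \<le> g v \<and> g v \<le> 1"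
    "\<And>e. e \<in> arcs H \<Longrightarrow> g (tail G e) < g (head G e)" using H.ex_potential th by auto
  \<comment> \<open>The potentials agree on the shared nodes \<open>s\<close> and \<open>t\<close>,
    so \<open>h\<close> extends both.\<close>
  define h where "h v = (if v \<in> verts G then f v else g v)" for v
  have hG: "h v = f v" if "v \<in> verts G" for v using that by (simp add: h_def)
  have hH: "h v = g v" if "v \<in> verts H" for v
  proof (cases "v \<in> verts G")
    case True
    then have "v = s \<or> v = t" using assms(4) that by auto
    then show ?thesis using f g True by (auto simp: h_def)
  qed (simp add: h_def)
  show ?thesis
  proof unfold_locales
    show "\<exists>e\<in>arcs (union G H). tail (union G H) e = v" if "v \<in> verts (union G H)" "v \<noteq> t" for v
      using that G.out_arc[of v] H.out_arc[of v] th by auto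
    have "h (tail G e) < h (head G e)" if "e \<in> arcs G \<union> arcs H" for e
      using that f(4)[of e] g(4)[of e] H.tail_in_verts[of e] H.head_in_verts[of e] th
      by (auto simp: hG hH)
    moreover have "0 \<le> h v \<and> h v \<le> 1" if "v \<in> verts G \<union> verts H" for v
      using that f(3)[of v] g(3)[of v] hG[of v] hH[of v] by auto
    moreover have "h s = 0" "h t = 1" using f hG G.s_in_verts G.t_in_verts by auto
    ultimately show "\<exists>pot::'a \<Rightarrow> real. pot s = 0 \<and> pot t = 1 \<and>
      (\<forall>v\<in>verts (union G H). 0 \<le> pot v \<and> pot v \<le> 1) \<and>
      (\<forall>e\<in>arcs (union G H). pot (tail (union G H) e) < pot (head (union G H) e))"
      by (intro exI[of _ h]) auto
  qed (use G.s_in_verts G.t_in_verts in auto)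
qed

lemma st_dag_series:
  assumes "st_dag G s m" "st_dag H m t" "compatible G H" "verts G \<inter> verts H = {m}"
  shows "st_dag (union G H) s t"
proof -
  interpret G: st_dag G s m by fact
  interpret H: st_dag H m t by fact
  interpret U: wf_digraph "union G H"
    by (rule wellformed_union[OF G.wf_digraph_axioms H.wf_digraph_axioms assms(3)])
  have th: "tail H = tail G" "head H = head G" using assms(3) by (auto simp: compatible_def)
  obtain f :: "'a \<Rightarrow> real" where f: "f s = 0" "f m = 1" "\<And>v. v \<in> verts G \<Longrightarrow> 0 \<le> f v \<and> f v \<le> 1"
    "\<And>e. e \<in> arcs G \<Longrightarrow> f (tail G e) < f (head G e)" using G.ex_potential by blast
  obtain g :: "'a \<Rightarrow> real" where g: "g m = 0" "g t = 1" "\<And>v. v \<in> verts H \<Longrightarrow> 0 \<le> g v \<and> g v \<le> 1"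
    "\<And>e. e \<in> arcs H \<Longrightarrow> g (tail G e) < g (head G e)" using H.ex_potential th by auto
  \<comment> \<open>The potentials are compressed to the halves [0, 1/2] and [1/2, 1]; both then
    take the value 1/2 at \<open>m\<close>.\<close>
  define h where "h v = (if v \<in> verts G then f v / 2 else (1 + g v) / 2)" for v
  have hG: "h v = f v / 2" if "v \<in> verts G" for v using that by (simp add: h_def)
  have hH: "h v = (1 + g v) / 2" if "v \<in> verts H" for v
    using that assms(4) f g by (cases "v = m") (auto simp: h_def)
  show ?thesis
  proof unfold_locales
    show "\<exists>e\<in>arcs (union G H). tail (union G H) e = v" if "v \<in> verts (union G H)" "v \<noteq> t" for v
      using that G.out_arc[of v] H.out_arc[of v] H.s_in_verts th by auto
    have "h (tail G e) < h (head G e)" if "e \<in> arcs G \<union> arcs H" for e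
      using that f(4)[of e] g(4)[of e] H.tail_in_verts[of e] H.head_in_verts[of e] th
      by (auto simp: hG hH)
    moreover have "0 \<le> h v \<and> h v \<le> 1" if "v \<in> verts G \<union> verts H" for v
      using that f(3)[of v] g(3)[of v] hG[of v] hH[of v] by auto
    moreover have "h s = 0" "h t = 1" using f(1) g(2) hG[OF G.s_in_verts] hH[OF H.t_in_verts] by auto
    ultimately show "\<exists>pot::'a \<Rightarrow> real. pot s = 0 \<and> pot t = 1 \<and>
      (\<forall>v\<in>verts (union G H). 0 \<le> pot v \<and> pot v \<le> 1) \<and>
      (\<forall>e\<in>arcs (union G H). pot (tail (union G H) e) < pot (head (union G H) e))"
      by (intro exI[of _ h]) auto
  qed (use G.s_in_verts H.t_in_verts in auto)
qed

lemma st_dag_single_arc: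
  assumes "s \<noteq> t" "verts G = {s, t}" "arcs G = {e}" "tail G e = s" "head G e = t"
  shows "st_dag G s t"
proof unfold_locales
  show "\<exists>pot::'a \<Rightarrow> real. pot s = 0 \<and> pot t = 1 \<and> (\<forall>v\<in>verts G. 0 \<le> pot v \<and> pot v \<le> 1) \<and>
      (\<forall>e\<in>arcs G. pot (tail G e) < pot (head G e))"
    using assms by (intro exI[of _ "\<lambda>v. if v = s then 0 else 1"]) auto
qed (use assms in auto)

lemma series_parallel_st_dag: "series_parallel G s t \<Longrightarrow> st_dag G s t"
  by (induction rule: series_parallel.induct)
    (auto intro: st_dag_single_arc st_dag_parallel st_dag_series)

section \<open>Size of the envelope of path costs\<close>

definition costs :: "('b \<Rightarrow> real) \<Rightarrow> ('b \<Rightarrow> real) \<Rightarrow> ('a, 'b) pre_digraph \<Rightarrow> 'a \<Rightarrow> 'a \<Rightarrow> (real \<times> real) set" where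
  "costs c d G u v = objective c d ` walks G u v"

lemma objective_Nil: "objective c d [] = 0"
  by (simp add: objective_def path_weight_def zero_prod_def)

lemma objective_Cons: "objective c d (e # p) = (c e, d e) + objective c d p"
  by (simp add: objective_def path_weight_def)

lemma objective_append: "objective c d (p @ q) = objective c d p + objective c d q"
  by (simp add: objective_def path_weight_def)

lemma objective_append_image:
  "objective c d ` {p @ q | p q. p \<in> P \<and> q \<in> Q} =
    {a + b | a b. a \<in> objective c d ` P \<and> b \<in> objective c d ` Q}" (is "?L = ?R")
proof
  show "?L \<subseteq> ?R"
  proof
    fix x assume "x \<in> ?L"
    then obtain p q where "x = objective c d (p @ q)" "p \<in> P" "q \<in> Q" by blast
    then show "x \<in> ?R" unfolding objective_append by blast
  qed
  show "?R \<subseteq> ?L"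
  proof
    fix x assume "x \<in> ?R"
    then obtain p q where "x = objective c d p + objective c d q" "p \<in> P" "q \<in> Q" by blast
    then show "x \<in> ?L" unfolding objective_append[symmetric] by blast
  qed
qed

lemma (in st_dag) finite_costs: "finite (costs c d G u v)"
  unfolding costs_def walks_def using finite_walks by simp

lemma (in st_dag) walks_t: "walks G t t = {[]}"
proof -
  have "awalk t p t \<longleftrightarrow> p = []" for p
    using tail_neq_t t_in_verts by (cases p) (auto simp: awalk_Nil_iff awalk_Cons_iff)
  then show ?thesis by (auto simp: walks_def)
qed

lemma card_envelope_singleton: "card (envelope {a}) \<le> 1"
  using card_mono[OF _ envelope_subset, of "{a}"] by simp

text \<open>Nonemptiness at all nodes is carried along because the count for Minkowski sums requires
  nonempty summands. The bound at an arbitrary node limits the labels of the dynamic program: such a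
  node sees the walks of its own component, possibly followed by those of the next one in series.
  The comparison of nodes and arcs later limits the number of rounds.\<close>

theorem series_parallel_envelope:
  assumes "series_parallel G s t"
  shows "card (verts G) \<le> card (arcs G) + 1 \<and>
    (\<forall>v\<in>verts G. walks G v t \<noteq> {} \<and> card (envelope (costs c d G v t)) \<le> card (arcs G)) \<and>
    int (card (envelope (costs c d G s t))) \<le> int (card (arcs G)) - int (card (verts G)) + 2"
  using assms
proof (induction rule: series_parallel.induct)
  case (single_arc s t G e)
  interpret st_dag G s t using single_arc by (rule st_dag_single_arc)
  have "awalk s p t \<longleftrightarrow> p = [e]" for p
  proof (cases p)
    case (Cons e' p')
    moreover have "awalk t p' t \<longleftrightarrow> p' = []" using walks_t by (auto simp: walks_def)
    ultimately show ?thesis using single_arc by (auto simp: awalk_Cons_iff)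
  qed (use s_neq_t in \<open>auto simp: awalk_Nil_iff\<close>)
  then have w: "walks G s t = {[e]}" by (auto simp: walks_def)
  show ?case using single_arc card_envelope_singleton by (auto simp: costs_def w walks_t)
next
  case (parallel G s t H)
  interpret G: st_dag G s t using parallel(1) by (rule series_parallel_st_dag)
  interpret H: st_dag H s t using parallel(2) by (rule series_parallel_st_dag)
  note dag = G.st_dag_axioms H.st_dag_axioms
  have dag': "verts H \<inter> verts G = {s, t}" using parallel by auto
  \<comment> \<open>Two shared nodes merge the two constants 2 of the bounds into one.\<close>
  have cv: "card (verts (union G H)) + 2 = card (verts G) + card (verts H)"
    using card_Un_Int[OF G.finite_verts H.finite_verts] parallel.hyps(4) G.s_neq_t by simp
  have ca: "card (arcs (union G H)) = card (arcs G) + card (arcs H)"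
    using card_Un_disjoint[OF G.finite_arcs H.finite_arcs] parallel.hyps(5) by simp
  have inner1: "walks (union G H) v t = walks G v t" if "v \<in> verts G" "v \<noteq> s" for v
    using walks_parallel_inner[OF dag] parallel that by blast
  have inner2: "walks (union G H) v t = walks H v t" if "v \<in> verts H" "v \<noteq> s" for v
    using walks_parallel_inner[OF dag(2,1) compatible_sym dag' that] parallel union_commute by metis
  have st: "walks (union G H) s t = walks G s t \<union> walks H s t"
    using walks_parallel[OF dag] parallel by blast
  have cs: "card (envelope (costs c d (union G H) s t))
      \<le> card (envelope (costs c d G s t)) + card (envelope (costs c d H s t))"
    using card_envelope_Un[OF G.finite_costs H.finite_costs] by (simp add: costs_def st image_Un)
  have "walks (union G H) v t \<noteq> {} \<and> card (envelope (costs c d (union G H) v t)) \<le> card (arcs (union G H))"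
    if v: "v \<in> verts G \<union> verts H" for v
  proof (cases "v = s")
    case True
    have "card (envelope (costs c d G s t)) \<le> card (arcs G)" "card (envelope (costs c d H s t)) \<le> card (arcs H)"
      "walks G s t \<noteq> {}" using parallel.IH G.s_in_verts H.s_in_verts by auto
    then show ?thesis using True cs ca st by auto
  next
    case False
    show ?thesis
    proof (cases "v \<in> verts G")
      case True
      then show ?thesis using inner1[OF True False] parallel.IH(1) ca by (force simp: costs_def)
    next
      case notG: False
      then show ?thesis using inner2[OF _ False] v parallel.IH(2) ca by (force simp: costs_def)
    qed
  qed
  then show ?case using parallel.IH cv ca cs by auto
next
  case (series G s m H t)
  interpret G: st_dag G s m using series(1) by (rule series_parallel_st_dag)
  interpret H: st_dag H m t using series(2) by (rule series_parallel_st_dag)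
  note dag = G.st_dag_axioms H.st_dag_axioms series.hyps(3,4)
  \<comment> \<open>Here one shared node and the piece saved by the sum do the same.\<close>
  have cv: "card (verts (union G H)) + 1 = card (verts G) + card (verts H)"
    using card_Un_Int[OF G.finite_verts H.finite_verts] series.hyps(4) by simp
  have ca: "card (arcs (union G H)) = card (arcs G) + card (arcs H)"
    using card_Un_disjoint[OF G.finite_arcs H.finite_arcs] series.hyps(5) by simp
  note right = walks_series_right[OF dag] and left = walks_series_left[OF dag]
  have ne: "walks G v m \<noteq> {}" if "v \<in> verts G" for v using series.IH that by blast
  have neH: "walks H m t \<noteq> {}" using series.IH H.s_in_verts by blast
  have cl: "card (envelope (costs c d (union G H) v t)) + 1
      \<le> card (envelope (costs c d G v m)) + card (envelope (costs c d H m t))" if v: "v \<in> verts G" for v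
  proof -
    have "costs c d (union G H) v t = {a + b | a b. a \<in> costs c d G v m \<and> b \<in> costs c d H m t}"
      unfolding costs_def left[OF v] by (rule objective_append_image)
    then show ?thesis
      using card_envelope_sum[OF G.finite_costs H.finite_costs] ne[OF v] neH by (simp add: costs_def)
  qed
  have "walks (union G H) v t \<noteq> {} \<and> card (envelope (costs c d (union G H) v t)) \<le> card (arcs (union G H))"
    if v: "v \<in> verts G \<union> verts H" for v
  proof (cases "v \<in> verts G")
    case True
    have "card (envelope (costs c d G v m)) \<le> card (arcs G)" "card (envelope (costs c d H m t)) \<le> card (arcs H)"
      using series.IH True H.s_in_verts by auto
    then show ?thesis using cl[OF True] ca left[OF True] ne[OF True] neH by auto
  next
    case False
    then show ?thesis using v right[of v] series.IH(2) ca by (force simp: costs_def)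
  qed
  moreover have "int (card (envelope (costs c d (union G H) s t)))
      \<le> int (card (arcs (union G H))) - int (card (verts (union G H))) + 2"
    using cl[OF G.s_in_verts] series.IH cv ca by linarith
  ultimately show ?case using series.IH cv ca by auto
qed

text \<open>Nonequivalence makes the objective injective on \<open>E\<close>, and vertices of the
  upper image are supported, so \<open>E\<close> embeds into the envelope.\<close>

theorem card_E_min:
  assumes sp: "series_parallel G s t" and E: "is_E_min G s t c d E"
  shows "finite E \<and> int (card E) \<le> int (card (arcs G)) - int (card (verts G)) + 2"
proof -
  interpret st_dag G s t using sp by (rule series_parallel_st_dag)
  have Esub: "E \<subseteq> efficient_extreme G s t c d" and inj: "inj_on (objective c d) E"
    using E by (auto simp: is_E_min_def nonequivalent_efficient_extreme_def equivalent_def inj_on_def)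
  have "E \<subseteq> walks G s t" using Esub by (auto simp: efficient_extreme_def walks_eq_st_paths)
  then have fin: "finite E" using finite_walks finite_subset unfolding walks_def by blast
  have "objective c d ` E \<subseteq> envelope (costs c d G s t)"
  proof
    fix a assume "a \<in> objective c d ` E"
    then obtain P where P: "P \<in> walks G s t" "a = objective c d P" "a extreme_point_of upper_image G s t c d"
      using Esub by (auto simp: efficient_extreme_def walks_eq_st_paths)
    then have "supported (costs c d G s t) a"
      using extreme_point_supported by (auto simp: upper_image_def costs_def walks_eq_st_paths)
    moreover have "a \<in> costs c d G s t" using P by (auto simp: costs_def)
    ultimately show "a \<in> envelope (costs c d G s t)"
      using envelope_iff_supported[OF finite_costs] by blast
  qed
  then have "card E \<le> card (envelope (costs c d G s t))"
    using card_inj_on_le[OF inj] finite_subset[OF envelope_subset finite_costs] by blast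
  then show ?thesis using series_parallel_envelope[OF sp, of c d] fin by linarith
qed

section \<open>Polynomial-time closure properties of the machine model\<close>

text \<open>Relocates a function body for linking. Only call targets move: a called body sees
  nothing but its argument, so variables stay valid.\<close>

fun shift :: "nat \<Rightarrow> expr \<Rightarrow> expr" where
  "shift k (Var i) = Var i"
| "shift k (Const c) = Const c"
| "shift k (Arith f a b) = Arith f (shift k a) (shift k b)"
| "shift k (MkPair a b) = MkPair (shift k a) (shift k b)"
| "shift k (Fst a) = Fst (shift k a)"
| "shift k (Snd a) = Snd (shift k a)"
| "shift k (IsPair a) = IsPair (shift k a)"
| "shift k (Cond a b c) = Cond (shift k a) (shift k b) (shift k c)"
| "shift k (Bind a b) = Bind (shift k a) (shift k b)"
| "shift k (Call i a) = Call (i + k) (shift k a)"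

lemma shift_0 [simp]: "shift 0 a = a"
  by (induction a) auto

text \<open>Linking costs no steps. Additional values go to the end of the environment, where they
  leave the existing de Bruijn indices intact.\<close>

lemma eval_embed:
  assumes "eval p env a v n"
  shows "eval (ps @ map (shift (length ps)) p @ qs) (env @ env') (shift (length ps) a) v n"
  using assms
proof (induction arbitrary: env' rule: eval.induct)
  case (eval_Var i env)
  then show ?case
    using eval.eval_Var[of i "env @ env'"] by (simp add: nth_append)
next
  case (eval_Call env a x m i v n)
  have "eval (ps @ map (shift (length ps)) p @ qs) [x] (shift (length ps) (p ! i)) v n"
    using eval_Call.IH(2)[of "[]"] by simp
  then show ?case using eval_Call by (auto intro!: eval.eval_Call simp: nth_append)
qed (auto intro: eval.intros simp del: One_nat_def)

lemma eval_append:
  assumes "eval p env a v n"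
  shows "eval (p @ qs) (env @ env') a v n"
proof -
  have "map (shift 0) p = p" by (simp add: map_idI)
  then show ?thesis using eval_embed[OF assms, of "[]"] by simp
qed

section \<open>Polynomial bounds and polynomial-time functions\<close>

lemma poly_nat_mono: "a \<le> b \<Longrightarrow> poly q a \<le> poly q b" for q :: "nat poly"
  by (induction q) (auto intro!: add_mono mult_mono)

text \<open>Bounds are kept as functions of the input, so that a bound read off an evaluation can be
  discharged by closure rules. Natural coefficients make polynomials monotone, which closes the
  class under composition.\<close>

definition pbound :: "('a \<Rightarrow> nat) \<Rightarrow> 'a set \<Rightarrow> ('a \<Rightarrow> nat) \<Rightarrow> bool" where
  "pbound sz D g \<longleftrightarrow> (\<exists>q :: nat poly. \<forall>x\<in>D. g x \<le> poly q (sz x))"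

lemma pbound_const: "pbound sz D (\<lambda>_. c)"
  unfolding pbound_def by (rule exI[of _ "[:c:]"]) simp

lemma pbound_id: "pbound sz D sz"
  unfolding pbound_def by (rule exI[of _ "[:0, 1:]"]) simp

lemma pbound_add: "pbound sz D f \<Longrightarrow> pbound sz D g \<Longrightarrow> pbound sz D (\<lambda>x. f x + g x)"
  unfolding pbound_def by (metis add_mono poly_add)

lemma pbound_mult: "pbound sz D f \<Longrightarrow> pbound sz D g \<Longrightarrow> pbound sz D (\<lambda>x. f x * g x)"
  unfolding pbound_def by (metis mult_le_mono poly_mult)

lemma pbound_poly:
  assumes "pbound sz D f"
  shows "pbound sz D (\<lambda>x. poly q (f x))"
proof -
  obtain r where "\<forall>x\<in>D. f x \<le> poly r (sz x)" using assms by (auto simp: pbound_def)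
  then have "\<forall>x\<in>D. poly q (f x) \<le> poly (q \<circ>\<^sub>p r) (sz x)"
    by (simp add: poly_pcompose poly_nat_mono)
  then show ?thesis unfolding pbound_def by blast
qed

lemma pbound_Suc: "pbound sz D f \<Longrightarrow> pbound sz D (\<lambda>x. Suc (f x))"
  using pbound_add[OF _ pbound_const, of sz D f 1] by simp

lemmas pbound_intros = pbound_const pbound_id pbound_Suc pbound_add pbound_mult pbound_poly

text \<open>Copying pointers is free in the machine model, so the size of the result has to be bounded
  in addition to the running time.\<close>

definition computes :: "program \<Rightarrow> expr \<Rightarrow> nat poly \<Rightarrow> 'a set \<Rightarrow> ('a \<Rightarrow> data) \<Rightarrow> ('b \<Rightarrow> data) \<Rightarrow> ('a \<Rightarrow> 'b) \<Rightarrow> bool"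
where
  "computes p e q D ea eb f \<longleftrightarrow> (\<forall>x\<in>D.
     data_size (eb (f x)) \<le> poly q (data_size (ea x)) \<and>
     (\<exists>n \<le> poly q (data_size (ea x)). eval p [ea x] e (eb (f x)) n))"

definition ptime :: "'a set \<Rightarrow> ('a \<Rightarrow> data) \<Rightarrow> ('b \<Rightarrow> data) \<Rightarrow> ('a \<Rightarrow> 'b) \<Rightarrow> bool" where
  "ptime D ea eb f \<longleftrightarrow> (\<exists>p e q. computes p e q D ea eb f)"

lemma computesD:
  assumes "computes p e q D ea eb f" "x \<in> D"
  shows "data_size (eb (f x)) \<le> poly q (data_size (ea x))"
    and "\<exists>n \<le> poly q (data_size (ea x)). eval p [ea x] e (eb (f x)) n"
  using assms unfolding computes_def by blast+

lemma ptimeI: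
  assumes "pbound (\<lambda>x. data_size (ea x)) D g"
    and "\<And>x. x \<in> D \<Longrightarrow> data_size (eb (f x)) \<le> g x"
    and "\<And>x. x \<in> D \<Longrightarrow> \<exists>n \<le> g x. eval p [ea x] e (eb (f x)) n"
  shows "ptime D ea eb f"
proof -
  obtain q :: "nat poly" where q: "\<And>x. x \<in> D \<Longrightarrow> g x \<le> poly q (data_size (ea x))"
    using assms(1) unfolding pbound_def by auto
  have "computes p e q D ea eb f"
    unfolding computes_def using assms(2,3) q by (meson order_trans)
  then show ?thesis unfolding ptime_def by blast
qed

lemma computes_embed:
  assumes "computes p e q D ea eb f"
  shows "computes (ps @ map (shift (length ps)) p @ qs) (shift (length ps) e) q D ea eb f"
proof -
  have "eval (ps @ map (shift (length ps)) p @ qs) [x] (shift (length ps) e) v n"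
    if "eval p [x] e v n" for x v n
    using eval_embed[OF that, of ps qs "[]"] by simp
  then show ?thesis using assms unfolding computes_def by blast
qed

lemma computes_append: "computes p e q D ea eb f \<Longrightarrow> computes (p @ qs) e q D ea eb f"
  using computes_embed[of p e q D ea eb f "[]" qs] by (simp add: map_idI)

text \<open>Places two programs in a common one, so that their expressions may occur side by side in
  a larger expression.\<close>

lemma ptime2E:
  assumes "ptime D ea eb f" "ptime D' ea' eb' f'"
  obtains p e q e' q' where "computes p e q D ea eb f" "computes p e' q' D' ea' eb' f'"
proof -
  obtain p e q p' e' q' where "computes p e q D ea eb f" "computes p' e' q' D' ea' eb' f'"
    using assms unfolding ptime_def by blast
  then have "computes (p @ map (shift (length p)) p') e q D ea eb f"
    "computes (p @ map (shift (length p)) p') (shift (length p) e') q' D' ea' eb' f'"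
    using computes_append computes_embed[of p' e' q' D' ea' eb' f' p "[]"] by auto
  then show thesis by (rule that)
qed

text \<open>Only the encoded result counts, and even its type may change; this turns the integer
  result of a comparison into a boolean and a pair into a list cell.\<close>

lemma ptime_cong:
  assumes "ptime D ea eb f" "\<And>x. x \<in> D \<Longrightarrow> eb (f x) = eb' (f' x)"
  shows "ptime D ea eb' f'"
  using assms unfolding ptime_def computes_def by simp

section \<open>Encodings and the size of integers\<close>

definition pairE :: "('a \<Rightarrow> data) \<Rightarrow> ('b \<Rightarrow> data) \<Rightarrow> 'a \<times> 'b \<Rightarrow> data" where
  "pairE e1 e2 x = PairD (e1 (fst x)) (e2 (snd x))"

definition boolE :: "bool \<Rightarrow> data" where
  "boolE b = IntD (if b then 1 else 0)"

definition listE :: "('a \<Rightarrow> data) \<Rightarrow> 'a list \<Rightarrow> data" where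
  "listE e xs = list_data (map e xs)"

definition natE :: "nat \<Rightarrow> data" where
  "natE n = nat_data n"

definition unitE :: "unit \<Rightarrow> data" where
  "unitE u = IntD 0"

lemma listE_simps [simp]:
  "listE e [] = IntD 0" "listE e (x # xs) = PairD (e x) (listE e xs)"
  by (simp_all add: listE_def)

lemma int_size_le_iff: "int_size k \<le> Suc w \<longleftrightarrow> \<bar>k\<bar> < 2 ^ w"
  by (auto simp: int_size_def floorlog_le_iff nat_less_iff)

lemma int_size_ge: "int_size k \<ge> 1"
  by (simp add: int_size_def)

lemma int_size_0 [simp]: "int_size 0 = 1"
  by (simp add: int_size_def floorlog_def)

lemma abs_less_int_size: "\<bar>k\<bar> < 2 ^ (int_size k - 1)"
  using int_size_le_iff[of k "int_size k - 1"] int_size_ge[of k] by simp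

lemma data_size_ge: "data_size x \<ge> 1"
  by (cases x) (simp_all add: int_size_def)

lemma abs_add_bound: "\<bar>a\<bar> < 2 ^ m \<Longrightarrow> \<bar>b\<bar> < 2 ^ n \<Longrightarrow> \<bar>a\<bar> + \<bar>b\<bar> < 2 ^ (m + n + 1)" for a b :: int
proof -
  assume "\<bar>a\<bar> < 2 ^ m" "\<bar>b\<bar> < 2 ^ n"
  moreover have "(2::int) ^ m \<le> 2 ^ (m + n)" "(2::int) ^ n \<le> 2 ^ (m + n)" by simp_all
  ultimately show ?thesis by (simp del: power_increasing_iff)
qed

text \<open>A size is one more than a bit length, so two sizes together leave room for a carry bit
  beyond the bit length of a product.\<close>

lemma int_size_arith: "int_size (apply_arith f a b) \<le> int_size a + int_size b"
proof -
  define A where "A = int_size a - 1"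
  define B where "B = int_size b - 1"
  have ab: "\<bar>a\<bar> < 2 ^ A" "\<bar>b\<bar> < 2 ^ B" using abs_less_int_size by (auto simp: A_def B_def)
  have "\<bar>apply_arith f a b\<bar> < 2 ^ (A + B + 1)"
  proof (cases f)
    case Times
    have "\<bar>a\<bar> * \<bar>b\<bar> \<le> 2 ^ A * 2 ^ B" by (rule mult_mono) (use ab in auto)
    also have "\<dots> < 2 ^ (A + B + 1)" by (simp add: power_add)
    finally show ?thesis using Times by (simp add: abs_mult)
  next
    case LessEq
    have "(1::int) < 2 ^ (A + B + 1)" by (rule one_less_power) simp_all
    then show ?thesis using LessEq by simp
  qed (use abs_add_bound[OF ab] in auto)
  then show ?thesis
    using int_size_le_iff[of "apply_arith f a b" "A + B + 1"] int_size_ge[of a] int_size_ge[of b]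
    by (simp add: A_def B_def)
qed

section \<open>Closure under composition, pairing, case distinction and arithmetic\<close>

lemma ptime_id: "ptime D ea ea (\<lambda>x. x)"
proof (rule ptimeI[where g = "\<lambda>x. data_size (ea x)" and e = "Var 0"])
  show "\<exists>n\<le>data_size (ea x). eval p [ea x] (Var 0) (ea x) n" for p x
    using eval_Var[of 0 "[ea x]" p] data_size_ge[of "ea x"] by auto
qed (auto intro: pbound_intros)

fun quote :: "data \<Rightarrow> expr" where
  "quote (IntD k) = Const k"
| "quote (PairD x y) = MkPair (quote x) (quote y)"

lemma eval_quote: "\<exists>n. \<forall>env. eval p env (quote d) d n"
  by (induction d) (auto intro: eval_Const eval_MkPair)

lemma ptime_const: "ptime D ea eb (\<lambda>_. c)"
proof -
  obtain n where "\<And>env. eval [] env (quote (eb c)) (eb c) n" using eval_quote by blast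
  then have "\<exists>m \<le> data_size (eb c) + n. eval [] env (quote (eb c)) (eb c) m" for env
    using le_add2 by blast
  then show ?thesis
    by (intro ptimeI[where g = "\<lambda>x. data_size (eb c) + n" and p = "[]" and e = "quote (eb c)"])
      (auto intro: pbound_intros)
qed

text \<open>The size half of \<open>computes\<close> is essential here: the time of \<open>g\<close>
  is polynomial in the size of \<open>f x\<close>, which the running time of \<open>f\<close> alone
  does not control.\<close>

lemma ptime_comp:
  assumes "ptime D ea eb f" "ptime D' eb ec g" "f ` D \<subseteq> D'"
  shows "ptime D ea ec (\<lambda>x. g (f x))"
proof -
  obtain p e q e' q' where f: "computes p e q D ea eb f" and g: "computes p e' q' D' eb ec g"
    using ptime2E[OF assms(1,2)] .
  note f = computesD[OF f] and g = computesD[OF g]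
  show ?thesis
  proof (rule ptimeI[where e = "Bind e e'" and p = p and g = "\<lambda>x. Suc (poly q (data_size (ea x)) +
        poly q' (poly q (data_size (ea x))))"])
    fix x assume x: "x \<in> D"
    then have fx: "f x \<in> D'" using assms(3) by blast
    have le: "poly q' (data_size (eb (f x))) \<le> poly q' (poly q (data_size (ea x)))"
      using f(1)[OF x] by (rule poly_nat_mono)
    show "data_size (ec (g (f x))) \<le> Suc (poly q (data_size (ea x)) + poly q' (poly q (data_size (ea x))))"
      using g(1)[OF fx] le by simp
    obtain n where n: "n \<le> poly q (data_size (ea x))" "eval p [ea x] e (eb (f x)) n" using f(2)[OF x] by blast
    obtain m where m: "m \<le> poly q' (data_size (eb (f x)))" "eval p [eb (f x)] e' (ec (g (f x))) m"
      using g(2)[OF fx] by blast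
    have "eval p ([eb (f x)] @ [ea x]) e' (ec (g (f x))) m"
      using eval_append[OF m(2), of "[]" "[ea x]"] by simp
    then have "eval p [ea x] (Bind e e') (ec (g (f x))) (Suc (n + m))"
      using eval_Bind[OF n(2)] by simp
    then show "\<exists>n\<le>Suc (poly q (data_size (ea x)) + poly q' (poly q (data_size (ea x)))).
        eval p [ea x] (Bind e e') (ec (g (f x))) n"
      using n(1) m(1) le by (intro exI conjI) auto
  qed (intro pbound_intros)
qed

lemma ptime_call: "ptime UNIV eb ec g \<Longrightarrow> ptime D ea eb f \<Longrightarrow> ptime D ea ec (\<lambda>x. g (f x))"
  by (rule ptime_comp) auto

lemma ptime_Pair:
  assumes "ptime D ea e1 f" "ptime D ea e2 g"
  shows "ptime D ea (pairE e1 e2) (\<lambda>x. (f x, g x))"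
proof -
  obtain p e q e' q' where f: "computes p e q D ea e1 f" and g: "computes p e' q' D ea e2 g"
    using ptime2E[OF assms(1,2)] .
  note f = computesD[OF f] and g = computesD[OF g]
  show ?thesis
  proof (rule ptimeI[where e = "MkPair e e'" and p = p and g = "\<lambda>x. Suc (poly q (data_size (ea x)) +
        poly q' (data_size (ea x)))"])
    fix x assume x: "x \<in> D"
    show "data_size (pairE e1 e2 (f x, g x)) \<le> Suc (poly q (data_size (ea x)) + poly q' (data_size (ea x)))"
      using f(1)[OF x] g(1)[OF x] by (simp add: pairE_def)
    obtain n m where "n \<le> poly q (data_size (ea x))" "eval p [ea x] e (e1 (f x)) n"
      "m \<le> poly q' (data_size (ea x))" "eval p [ea x] e' (e2 (g x)) m" using f(2)[OF x] g(2)[OF x] by blast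
    then show "\<exists>n\<le>Suc (poly q (data_size (ea x)) + poly q' (data_size (ea x))).
        eval p [ea x] (MkPair e e') (pairE e1 e2 (f x, g x)) n"
      by (intro exI[of _ "Suc (n + m)"]) (auto simp: pairE_def intro: eval_MkPair)
  qed (intro pbound_intros)
qed

text \<open>The branches are packed into one pair, so that linking two programs suffices. Both get
  evaluated, which merely adds their times.\<close>

lemma ptime_If:
  assumes "ptime D ea boolE b" "ptime D ea eb f" "ptime D ea eb g"
  shows "ptime D ea eb (\<lambda>x. if b x then f x else g x)"
proof -
  obtain p e q e' q' where b: "computes p e q D ea boolE b"
    and fg: "computes p e' q' D ea (pairE eb eb) (\<lambda>x. (f x, g x))"
    using ptime2E[OF assms(1) ptime_Pair[OF assms(2,3)]] .
  note b = computesD(2)[OF b] and fg = computesD[OF fg]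
  show ?thesis
  proof (rule ptimeI[where e = "Cond e (Fst e') (Snd e')" and p = p and
        g = "\<lambda>x. Suc (Suc (poly q (data_size (ea x)) + poly q' (data_size (ea x))))"])
    fix x assume x: "x \<in> D"
    show "data_size (eb (if b x then f x else g x))
        \<le> Suc (Suc (poly q (data_size (ea x)) + poly q' (data_size (ea x))))"
      using fg(1)[OF x] by (simp add: pairE_def)
    obtain n m where nm: "n \<le> poly q (data_size (ea x))" "eval p [ea x] e (boolE (b x)) n"
      "m \<le> poly q' (data_size (ea x))" "eval p [ea x] e' (PairD (eb (f x)) (eb (g x))) m"
      using b[OF x] fg(2)[OF x] by (auto simp: pairE_def)
    have "eval p [ea x] (Cond e (Fst e') (Snd e')) (eb (if b x then f x else g x)) (Suc (n + Suc m))"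
    proof (cases "b x")
      case True
      then show ?thesis using eval_Cond_True[OF _ _ eval_Fst[OF nm(4)], of e 1 n] nm(2)
        by (simp add: boolE_def)
    next
      case False
      then show ?thesis using eval_Cond_False[OF _ eval_Snd[OF nm(4)], of e n] nm(2)
        by (simp add: boolE_def)
    qed
    then show "\<exists>n\<le>Suc (Suc (poly q (data_size (ea x)) + poly q' (data_size (ea x)))).
        eval p [ea x] (Cond e (Fst e') (Snd e')) (eb (if b x then f x else g x)) n"
      using nm by (intro exI conjI) auto
  qed (intro pbound_intros)
qed

lemma eval_Var0: "eval p [v] (Var 0) v 1"
  using eval_Var[of 0 "[v]" p] by simp

lemma ptime_fst: "ptime D ea (pairE e1 e2) f \<Longrightarrow> ptime D ea e1 (\<lambda>x. fst (f x))"
proof (erule ptime_call[rotated])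
  show "ptime UNIV (pairE e1 e2) e1 fst"
  proof (rule ptimeI[where e = "Fst (Var 0)" and g = "\<lambda>x. data_size (pairE e1 e2 x) + 2"])
    show "\<exists>n \<le> data_size (pairE e1 e2 x) + 2. eval p [pairE e1 e2 x] (Fst (Var 0)) (e1 (fst x)) n" for p x
      using eval_Fst[OF eval_Var0] by (intro exI[of _ 2]) (auto simp: pairE_def numeral_2_eq_2)
  qed (auto simp: pairE_def intro!: pbound_intros)
qed

lemma ptime_snd: "ptime D ea (pairE e1 e2) f \<Longrightarrow> ptime D ea e2 (\<lambda>x. snd (f x))"
proof (erule ptime_call[rotated])
  show "ptime UNIV (pairE e1 e2) e2 snd"
  proof (rule ptimeI[where e = "Snd (Var 0)" and g = "\<lambda>x. data_size (pairE e1 e2 x) + 2"])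
    show "\<exists>n \<le> data_size (pairE e1 e2 x) + 2. eval p [pairE e1 e2 x] (Snd (Var 0)) (e2 (snd x)) n" for p x
      using eval_Snd[OF eval_Var0] by (intro exI[of _ 2]) (auto simp: pairE_def numeral_2_eq_2)
  qed (auto simp: pairE_def intro!: pbound_intros)
qed

lemma ptime_call2:
  assumes "ptime UNIV (pairE e1 e2) eb (\<lambda>z. h (fst z) (snd z))" "ptime D ea e1 f" "ptime D ea e2 g"
  shows "ptime D ea eb (\<lambda>x. h (f x) (g x))"
  using ptime_call[OF assms(1) ptime_Pair[OF assms(2,3)]] by simp

lemma ptime_call3:
  assumes "ptime UNIV (pairE (pairE e1 e2) e3) eb (\<lambda>z. h (fst (fst z)) (snd (fst z)) (snd z))"
    and "ptime D ea e1 f" "ptime D ea e2 g" "ptime D ea e3 k"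
  shows "ptime D ea eb (\<lambda>x. h (f x) (g x) (k x))"
  using ptime_call[OF assms(1) ptime_Pair[OF ptime_Pair[OF assms(2,3)] assms(4)]] by simp

lemma ptime_arith:
  assumes "ptime D ea IntD f" "ptime D ea IntD g"
  shows "ptime D ea IntD (\<lambda>x. apply_arith h (f x) (g x))"
proof (rule ptime_call2[OF _ assms])
  let ?E = "Arith h (Fst (Var 0)) (Snd (Var 0))"
  show "ptime UNIV (pairE IntD IntD) IntD (\<lambda>z. apply_arith h (fst z) (snd z))"
  proof (rule ptimeI[where e = ?E and g = "\<lambda>x. data_size (pairE IntD IntD x) + 5"])
    show "\<exists>n\<le>data_size (pairE IntD IntD z) + 5. eval p [pairE IntD IntD z] ?E
        (IntD (apply_arith h (fst z) (snd z))) n" for p and z :: "int \<times> int"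
    proof -
      have v: "eval p [pairE IntD IntD z] (Var 0) (PairD (IntD (fst z)) (IntD (snd z))) 1"
        using eval_Var0 by (simp add: pairE_def)
      show ?thesis using eval_Arith[OF eval_Fst[OF v] eval_Snd[OF v], of h]
        by (intro exI conjI) (auto simp: pairE_def)
    qed
    show "data_size (IntD (apply_arith h (fst z) (snd z))) \<le> data_size (pairE IntD IntD z) + 5" for z
      using int_size_arith[of h "fst z" "snd z"] by (simp add: pairE_def)
  qed (auto intro!: pbound_intros)
qed

lemmas ptime_plus = ptime_arith[where h = Plus, simplified]
lemmas ptime_minus = ptime_arith[where h = Minus, simplified]
lemmas ptime_times = ptime_arith[where h = Times, simplified]

lemma ptime_le: "ptime D ea IntD f \<Longrightarrow> ptime D ea IntD g \<Longrightarrow> ptime D ea boolE (\<lambda>x. f x \<le> g x)"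
  by (rule ptime_cong[OF ptime_arith[where h = LessEq]]) (auto simp: boolE_def)

lemma ptime_not: "ptime D ea boolE f \<Longrightarrow> ptime D ea boolE (\<lambda>x. \<not> f x)"
  by (rule ptime_cong[OF ptime_If[OF _ ptime_const[of D ea boolE False] ptime_const[of D ea boolE True]]]) auto

lemma ptime_conj: "ptime D ea boolE f \<Longrightarrow> ptime D ea boolE g \<Longrightarrow> ptime D ea boolE (\<lambda>x. f x \<and> g x)"
  by (rule ptime_cong[OF ptime_If[of D ea f boolE g "\<lambda>_. False"]]) (auto intro: ptime_const)

lemma ptime_disj: "ptime D ea boolE f \<Longrightarrow> ptime D ea boolE g \<Longrightarrow> ptime D ea boolE (\<lambda>x. f x \<or> g x)"
  by (rule ptime_cong[OF ptime_If[of D ea f boolE "\<lambda>_. True" g]]) (auto intro: ptime_const)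

lemma ptime_nat: "ptime D ea natE f \<longleftrightarrow> ptime D ea IntD (\<lambda>x. int (f x))"
  unfolding ptime_def computes_def by (simp add: natE_def)

lemma ptime_nat_Suc: "ptime D ea natE f \<Longrightarrow> ptime D ea natE (\<lambda>x. Suc (f x))"
  unfolding ptime_nat using ptime_plus[OF _ ptime_const[of D ea IntD 1], of "\<lambda>x. int (f x)"]
  by (simp add: add.commute)

lemma ptime_nat_eq:
  assumes "ptime D ea natE f" "ptime D ea natE g"
  shows "ptime D ea boolE (\<lambda>x. f x = g x)"
proof -
  have "ptime D ea boolE (\<lambda>x. int (f x) \<le> int (g x) \<and> int (g x) \<le> int (f x))"
    using assms unfolding ptime_nat by (intro ptime_conj ptime_le)
  then show ?thesis by (rule ptime_cong) (auto simp: eq_iff)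
qed

section \<open>Lists and bounded iteration\<close>

lemma ptime_Cons:
  assumes "ptime D ea e f" "ptime D ea (listE e) g"
  shows "ptime D ea (listE e) (\<lambda>x. f x # g x)"
  by (rule ptime_cong[OF ptime_Pair[OF assms]]) (simp add: pairE_def)

lemma data_size_listE: "data_size (listE e xs) = Suc (\<Sum>x\<leftarrow>xs. Suc (data_size (e x)))"
  by (induction xs) auto

lemma length_le_listE: "length xs \<le> data_size (listE e xs)"
proof -
  have "length xs \<le> (\<Sum>x\<leftarrow>xs. Suc (data_size (e x)))" by (induction xs) auto
  then show ?thesis by (simp add: data_size_listE)
qed

lemma elem_le_listE: "x \<in> set xs \<Longrightarrow> data_size (e x) \<le> data_size (listE e xs)"
  using member_le_sum_list[of "Suc (data_size (e x))" "map (\<lambda>x. Suc (data_size (e x))) xs"]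
  by (simp add: data_size_listE)

text \<open>A loop on a fixed context, the remaining list and the accumulator, nested as
  \<open>PairD c (PairD xs s)\<close>. It is meant to sit at index \<open>i\<close> and call itself;
  \<open>e\<close> finds context, head and accumulator in its first variable. The end of the list is
  recognised by not being a pair.\<close>

definition fold_body :: "nat \<Rightarrow> expr \<Rightarrow> expr" where
  "fold_body i e =
     Cond (IsPair (Fst (Snd (Var 0))))
       (Call i (MkPair (Fst (Var 0)) (MkPair (Snd (Fst (Snd (Var 0))))
         (Bind (MkPair (MkPair (Fst (Var 0)) (Fst (Fst (Snd (Var 0))))) (Snd (Snd (Var 0)))) e))))
       (Snd (Snd (Var 0)))"

text \<open>The bound \<open>T\<close> is demanded only for states that occur on this run, which
  permits size bounds that rest on an invariant of the run. The constants 30 and 10 generously cover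
  the pointer work of one iteration and of the exit.\<close>

lemma eval_fold_body:
  assumes i: "i < length p" "p ! i = fold_body i e"
    and step: "\<And>k. k < length xs \<Longrightarrow>
      \<exists>m\<le>T. eval p [PairD (PairD c (ey (xs ! k))) (es (fold f (take k xs) s))] e
        (es (f (xs ! k) (fold f (take k xs) s))) m"
  shows "\<exists>n \<le> length xs * (T + 30) + 10.
     eval p [PairD c (PairD (listE ey xs) (es s))] (fold_body i e) (es (fold f xs s)) n"
  using step
proof (induction xs arbitrary: s)
  case Nil
  let ?V = "PairD c (PairD (listE ey []) (es s))"
  have sV: "eval p [?V] (Snd (Var 0)) (PairD (IntD 0) (es s)) 2"
    using eval_Snd[OF eval_Var0, of p c "PairD (IntD 0) (es s)"] by (simp add: numeral_2_eq_2)
  have "eval p [?V] (fold_body i e) (es s) (Suc (Suc (Suc 2) + Suc 2))"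
    unfolding fold_body_def
    by (rule eval_Cond_False[OF eval_IsPair_IntD[OF eval_Fst[OF sV]] eval_Snd[OF sV]])
  then show ?case by (intro exI conjI) auto
next
  case (Cons x xs)
  let ?V = "PairD c (PairD (PairD (ey x) (listE ey xs)) (es s))"
  obtain m where m: "m \<le> T" "eval p [PairD (PairD c (ey x)) (es s)] e (es (f x s)) m"
    using Cons.prems[of 0] by auto
  have "\<exists>m\<le>T. eval p [PairD (PairD c (ey (xs ! k))) (es (fold f (take k xs) (f x s)))] e
      (es (f (xs ! k) (fold f (take k xs) (f x s)))) m" if "k < length xs" for k
    using Cons.prems[of "Suc k"] that by simp
  from Cons.IH[OF this] obtain n where n: "n \<le> length xs * (T + 30) + 10"
    "eval p [PairD c (PairD (listE ey xs) (es (f x s)))] (fold_body i e) (es (fold f xs (f x s))) n" by auto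
  note v = eval_Var0[of p ?V]
  have "eval p ([PairD (PairD c (ey x)) (es s)] @ [?V]) e (es (f x s)) m"
    using eval_append[OF m(2), of "[]"] by simp
  then have m': "eval p [PairD (PairD c (ey x)) (es s), ?V] e (es (f x s)) m" by simp
  note b = eval_Bind[OF eval_MkPair[OF eval_MkPair[OF eval_Fst[OF v] eval_Fst[OF eval_Fst[OF eval_Snd[OF v]]]]
    eval_Snd[OF eval_Snd[OF v]]] m']
  note a = eval_MkPair[OF eval_Fst[OF v] eval_MkPair[OF eval_Snd[OF eval_Fst[OF eval_Snd[OF v]]] b]]
  have "eval p [PairD c (PairD (listE ey xs) (es (f x s)))] (p ! i) (es (fold f xs (f x s))) n"
    using n(2) i by simp
  note c = eval_Cond_True[OF eval_IsPair_PairD[OF eval_Fst[OF eval_Snd[OF v]]] _ eval_Call[OF a i(1) this]]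
  have "eval p [?V] (fold_body i e) (es (fold f (x # xs) s)) (26 + m + n)"
    unfolding fold_body_def using c[of "Snd (Snd (Var 0))"] by (simp add: eval_nat_numeral)
  then show ?case using n(1) m(1) by (intro exI[of _ "26 + m + n"]) auto
qed

text \<open>As in Cobham's bounded recursion on notation, a polynomial bound on the intermediate states
  has to be supplied.\<close>

lemma ptime_fold:
  assumes step: "ptime UNIV (pairE (pairE ea ey) es) es (\<lambda>z. f (fst (fst z)) (snd (fst z)) (snd z))"
    and l: "ptime D ea (listE ey) l" and a: "ptime D ea es a"
    and bound: "pbound (\<lambda>x. data_size (ea x)) D b"
      "\<And>x k. x \<in> D \<Longrightarrow> k \<le> length (l x) \<Longrightarrow> data_size (es (fold (f x) (take k (l x)) (a x))) \<le> b x"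
  shows "ptime D ea es (\<lambda>x. fold (f x) (l x) (a x))"
proof -
  \<comment> \<open>The input itself is passed along as context, since the step may depend on
    it.\<close>
  have arg: "ptime D ea (pairE ea (pairE (listE ey) es)) (\<lambda>x. (x, (l x, a x)))"
    by (intro ptime_Pair ptime_id l a)
  obtain p e q e' q' where
    st: "computes p e q UNIV (pairE (pairE ea ey) es) es (\<lambda>z. f (fst (fst z)) (snd (fst z)) (snd z))"
    and la: "computes p e' q' D ea (pairE ea (pairE (listE ey) es)) (\<lambda>x. (x, (l x, a x)))"
    using ptime2E[OF step arg] .
  define i where "i = length p"
  define P where "P = p @ [fold_body i e]"
  have P: "i < length P" "P ! i = fold_body i e" by (simp_all add: P_def i_def)
  note st = computesD[OF computes_append[OF st, of "[fold_body i e]", folded P_def]]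
    and la = computesD[OF computes_append[OF la, of "[fold_body i e]", folded P_def]]
  define sz where "sz x = data_size (ea x)" for x
  \<comment> \<open>The argument of one step consists of the input, an element no larger than the
    whole list, the accumulator and two pair cells.\<close>
  define T where "T x = poly q (Suc (Suc (sz x + poly q' (sz x)) + b x))" for x
  define g where "g x = poly q' (sz x) + (poly q' (sz x) * (T x + 30) + 10) + b x + 3" for x
  show ?thesis
  proof (rule ptimeI[where e = "Bind e' (Call i (Var 0))" and p = P and g = g])
    show "pbound (\<lambda>x. data_size (ea x)) D g"
      unfolding g_def T_def sz_def by (intro pbound_intros bound(1))
  next
    fix x assume x: "x \<in> D"
    show "data_size (es (fold (f x) (l x) (a x))) \<le> g x"
      using bound(2)[OF x, of "length (l x)"] by (simp add: g_def)
    have lx: "data_size (listE ey (l x)) \<le> poly q' (sz x)"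
      using la(1)[OF x] by (simp add: pairE_def sz_def)
    obtain m where m: "m \<le> poly q' (sz x)"
      "eval P [ea x] e' (PairD (ea x) (PairD (listE ey (l x)) (es (a x)))) m"
      using la(2)[OF x] by (auto simp: pairE_def sz_def)
    have "\<exists>n \<le> length (l x) * (T x + 30) + 10.
      eval P [PairD (ea x) (PairD (listE ey (l x)) (es (a x)))] (fold_body i e) (es (fold (f x) (l x) (a x))) n"
    proof (rule eval_fold_body[OF P])
      fix k assume k: "k < length (l x)"
      let ?z = "((x, l x ! k), fold (f x) (take k (l x)) (a x))"
      have "data_size (ey (l x ! k)) \<le> poly q' (sz x)"
        using elem_le_listE[of "l x ! k" "l x" ey] k lx by simp
      then have "data_size (pairE (pairE ea ey) es ?z) \<le> Suc (Suc (sz x + poly q' (sz x)) + b x)"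
        using bound(2)[OF x, of k] k by (simp add: pairE_def sz_def)
      then have "poly q (data_size (pairE (pairE ea ey) es ?z)) \<le> T x"
        unfolding T_def by (rule poly_nat_mono)
      then show "\<exists>m\<le>T x. eval P [PairD (PairD (ea x) (ey (l x ! k))) (es (fold (f x) (take k (l x)) (a x)))] e
        (es (f x (l x ! k) (fold (f x) (take k (l x)) (a x)))) m"
        using st(2)[of ?z] by (auto simp: pairE_def intro: order_trans)
    qed
    then obtain n where n: "n \<le> length (l x) * (T x + 30) + 10"
      "eval P [PairD (ea x) (PairD (listE ey (l x)) (es (a x)))] (P ! i) (es (fold (f x) (l x) (a x))) n"
      using P by auto
    have "length (l x) \<le> poly q' (sz x)" using length_le_listE[of "l x" ey] lx by simp
    then have "length (l x) * (T x + 30) \<le> poly q' (sz x) * (T x + 30)" by (rule mult_le_mono1)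
    moreover have "eval P [v, w] (Var 0) v 1" for v w
      using eval_Var[of 0 "[v, w]" P] by simp
    then have "eval P [ea x] (Bind e' (Call i (Var 0))) (es (fold (f x) (l x) (a x))) (Suc (m + Suc (1 + n)))"
      using eval_Bind[OF m(2) eval_Call[OF _ P(1) n(2)]] by blast
    ultimately show "\<exists>n\<le>g x. eval P [ea x] (Bind e' (Call i (Var 0))) (es (fold (f x) (l x) (a x))) n"
      using m(1) n(1) unfolding g_def by (intro exI[of _ "Suc (m + Suc (1 + n))"] conjI) linarith+
  qed
qed

lemma ptimeD_size: "ptime D ea eb f \<Longrightarrow> \<exists>q. \<forall>x\<in>D. data_size (eb (f x)) \<le> poly q (data_size (ea x))"
  unfolding ptime_def computes_def by blast

lemma listE_take_le: "data_size (listE e (take k xs)) \<le> data_size (listE e xs)"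
proof -
  have "(\<Sum>x\<leftarrow>take k xs. g x) \<le> (\<Sum>x\<leftarrow>xs. g x)" for g :: "_ \<Rightarrow> nat"
    by (metis append_take_drop_id le_add1 map_append sum_list_append)
  then show ?thesis by (simp add: data_size_listE)
qed

lemma data_size_append: "data_size (listE e (xs @ ys)) + 1 = data_size (listE e xs) + data_size (listE e ys)"
  by (simp add: data_size_listE)

lemma fold_Cons_rev: "fold (\<lambda>y s. y # s) xs s = rev xs @ s"
  by (induction xs arbitrary: s) auto

lemma data_size_rev: "data_size (listE e (rev xs)) = data_size (listE e xs)"
  by (simp add: data_size_listE rev_map[symmetric])

text \<open>Consing reverses the order, so prepending a reversed list is the natural loop;
  \<open>rev\<close> and \<open>@\<close> are derived from it.\<close>

lemma ptime_revapp:
  assumes "ptime D ea (listE e) f" "ptime D ea (listE e) g"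
  shows "ptime D ea (listE e) (\<lambda>x. rev (f x) @ g x)"
proof -
  obtain q q' where q: "\<And>x. x \<in> D \<Longrightarrow> data_size (listE e (f x)) \<le> poly q (data_size (ea x))"
    and q': "\<And>x. x \<in> D \<Longrightarrow> data_size (listE e (g x)) \<le> poly q' (data_size (ea x))"
    using ptimeD_size[OF assms(1)] ptimeD_size[OF assms(2)] by auto
  have "ptime D ea (listE e) (\<lambda>x. fold (\<lambda>y s. y # s) (f x) (g x))"
  proof (rule ptime_fold[where b = "\<lambda>x. poly q (data_size (ea x)) + poly q' (data_size (ea x))"])
    fix x k assume x: "x \<in> D"
    have "data_size (listE e (fold (\<lambda>y s. y # s) (take k (f x)) (g x)))
        \<le> data_size (listE e (take k (f x))) + data_size (listE e (g x))"
      using data_size_append[of e "rev (take k (f x))" "g x"]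
      by (simp add: fold_Cons_rev data_size_rev)
    also have "\<dots> \<le> poly q (data_size (ea x)) + poly q' (data_size (ea x))"
      using q[OF x] q'[OF x] listE_take_le[of e k "f x"] by (meson add_mono order_trans)
    finally show "data_size (listE e (fold (\<lambda>y s. y # s) (take k (f x)) (g x)))
        \<le> poly q (data_size (ea x)) + poly q' (data_size (ea x))" .
  qed (rule assms ptime_Cons ptime_id ptime_fst ptime_snd pbound_intros)+
  then show ?thesis by (simp add: fold_Cons_rev)
qed

lemma ptime_rev: "ptime D ea (listE e) f \<Longrightarrow> ptime D ea (listE e) (\<lambda>x. rev (f x))"
  using ptime_revapp[OF _ ptime_const[of D ea "listE e" "[]"]] by simp

lemma ptime_append:
  assumes "ptime D ea (listE e) f" "ptime D ea (listE e) g"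
  shows "ptime D ea (listE e) (\<lambda>x. f x @ g x)"
  using ptime_revapp[OF ptime_rev[OF assms(1)] assms(2)] by simp

lemma fold_revapp: "fold (\<lambda>y s. rev (f y) @ s) xs s = rev (concat (map f xs)) @ s"
  by (induction xs arbitrary: s) auto

text \<open>Common source of \<open>map\<close> and \<open>filter\<close>. A block is bounded by
  \<open>B x\<close> because its argument is an element of the list, and the accumulator holds at
  most one block per element.\<close>

lemma ptime_concat_map:
  assumes f: "ptime UNIV (pairE ea ey) (listE e) (\<lambda>z. f (fst z) (snd z))"
    and l: "ptime D ea (listE ey) l"
  shows "ptime D ea (listE e) (\<lambda>x. concat (map (f x) (l x)))"
proof -
  obtain q where q: "\<And>x. x \<in> D \<Longrightarrow> data_size (listE ey (l x)) \<le> poly q (data_size (ea x))"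
    using ptimeD_size[OF l] by auto
  obtain r where r: "\<And>z. z \<in> UNIV \<Longrightarrow> data_size (listE e (f (fst z) (snd z))) \<le> poly r (data_size (pairE ea ey z))"
    using ptimeD_size[OF f] by blast
  then have r: "data_size (listE e (f x y)) \<le> poly r (Suc (data_size (ea x) + data_size (ey y)))" for x y
    using r[of "(x, y)"] by (simp add: pairE_def)
  define B where "B x = poly r (Suc (data_size (ea x) + poly q (data_size (ea x))))" for x
  have "ptime D ea (listE e) (\<lambda>x. fold (\<lambda>y s. rev (f x y) @ s) (l x) [])"
  proof (rule ptime_fold[where b = "\<lambda>x. Suc (poly q (data_size (ea x)) * B x)"])
    fix x k assume x: "x \<in> D"
    have *: "data_size (listE e (f x y)) \<le> B x" if "y \<in> set (l x)" for y
    proof -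
      have "data_size (ey y) \<le> poly q (data_size (ea x))"
        using elem_le_listE[OF that, of ey] q[OF x] by simp
      then show ?thesis unfolding B_def by (intro order_trans[OF r poly_nat_mono]) simp
    qed
    have "data_size (listE e (concat (map (f x) ys))) \<le> Suc (length ys * B x)" if "set ys \<subseteq> set (l x)" for ys
      using that
    proof (induction ys)
      case (Cons y ys)
      then show ?case using *[of y] data_size_append[of e "f x y" "concat (map (f x) ys)"] by simp
    qed simp
    from this[OF set_take_subset]
    have "data_size (listE e (fold (\<lambda>y s. rev (f x y) @ s) (take k (l x)) [])) \<le> Suc (length (take k (l x)) * B x)"
      by (simp add: fold_revapp data_size_rev)
    also have "length (take k (l x)) \<le> poly q (data_size (ea x))"
      using length_le_listE[of "l x" ey] q[OF x] by simp
    finally show "data_size (listE e (fold (\<lambda>y s. rev (f x y) @ s) (take k (l x)) []))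
        \<le> Suc (poly q (data_size (ea x)) * B x)" by simp
  next
    show "ptime UNIV (pairE (pairE ea ey) (listE e)) (listE e)
        (\<lambda>z. rev (f (fst (fst z)) (snd (fst z))) @ snd z)"
      by (rule ptime_id ptime_revapp ptime_snd ptime_call2[OF f] ptime_fst)+
  qed (auto simp: B_def intro!: l ptime_const pbound_intros)
  then have "ptime D ea (listE e) (\<lambda>x. rev (fold (\<lambda>y s. rev (f x y) @ s) (l x) []))"
    by (rule ptime_rev)
  then show ?thesis by (simp add: fold_revapp)
qed

lemma ptime_map:
  assumes "ptime UNIV (pairE ea ey) e (\<lambda>z. f (fst z) (snd z))" "ptime D ea (listE ey) l"
  shows "ptime D ea (listE e) (\<lambda>x. map (f x) (l x))"
proof -
  have "ptime D ea (listE e) (\<lambda>x. concat (map (\<lambda>y. [f x y]) (l x)))"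
    by (rule assms ptime_const ptime_concat_map ptime_Cons)+
  then show ?thesis by simp
qed

lemma ptime_filter:
  assumes "ptime UNIV (pairE ea e) boolE (\<lambda>z. P (fst z) (snd z))" "ptime D ea (listE e) l"
  shows "ptime D ea (listE e) (\<lambda>x. filter (P x) (l x))"
proof -
  have "ptime D ea (listE e) (\<lambda>x. concat (map (\<lambda>y. if P x y then [y] else []) (l x)))"
    by (rule assms ptime_const ptime_id ptime_concat_map ptime_If ptime_Cons ptime_snd)+
  moreover have "concat (map (\<lambda>y. if P x y then [y] else []) xs) = filter (P x) xs" for x xs
    by (induction xs) auto
  ultimately show ?thesis by simp
qed

lemma ptime_list_ex:
  assumes "ptime UNIV (pairE ea e) boolE (\<lambda>z. P (fst z) (snd z))" "ptime D ea (listE e) l"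
  shows "ptime D ea boolE (\<lambda>x. list_ex (P x) (l x))"
proof -
  have *: "fold (\<lambda>y b. P y \<or> b) xs b = (list_ex P xs \<or> b)" for P xs and b
    by (induction xs arbitrary: b) auto
  have "ptime D ea boolE (\<lambda>x. fold (\<lambda>y b. P x y \<or> b) (l x) False)"
  proof (rule ptime_fold[where b = "\<lambda>_. data_size (boolE True) + data_size (boolE False)"])
    show "data_size (boolE (fold (\<lambda>y b. P x y \<or> b) (take k (l x)) False))
        \<le> data_size (boolE True) + data_size (boolE False)" for x k
      by (cases "fold (\<lambda>y b. P x y \<or> b) (take k (l x)) False") auto
    show "ptime UNIV (pairE (pairE ea e) boolE) boolE (\<lambda>z. P (fst (fst z)) (snd (fst z)) \<or> snd z)"
      by (rule ptime_id ptime_disj ptime_call2[OF assms(1)] ptime_fst ptime_snd)+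
  qed (rule assms ptime_const pbound_const)+
  then show ?thesis by (simp add: *)
qed

lemma ptime_list_all:
  assumes "ptime UNIV (pairE ea e) boolE (\<lambda>z. P (fst z) (snd z))" "ptime D ea (listE e) l"
  shows "ptime D ea boolE (\<lambda>x. list_all (P x) (l x))"
proof -
  have "ptime D ea boolE (\<lambda>x. \<not> list_ex (\<lambda>y. \<not> P x y) (l x))"
    by (rule assms ptime_not ptime_list_ex)+
  then show ?thesis by (simp add: list_all_iff list_ex_iff)
qed

text \<open>Solvability runs function 0, so the main expression is placed in front and all calls are
  shifted by one; the constant 2 pays for the outer \<open>Call\<close> and its argument.\<close>

lemma polynomial_time_solvableI:
  assumes "ptime instances encode eb f"
    and "\<And>x. x \<in> instances \<Longrightarrow> correct x (eb (f x))"
  shows "polynomial_time_solvable instances encode correct"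
proof -
  obtain p e q where c: "computes p e q instances encode eb f"
    using assms(1) unfolding ptime_def by blast
  have *: "computes (shift 1 e # map (shift 1) p) (shift 1 e) q instances encode eb f"
    using computes_embed[OF c, of "[shift 1 e]" "[]"] by simp
  have "\<exists>v n. eval (shift 1 e # map (shift 1) p) [encode x] (Call 0 (Var 0)) v n \<and>
      n \<le> poly (q + [:2:]) (data_size (encode x)) \<and> correct x v" if x: "x \<in> instances" for x
  proof -
    obtain n where "n \<le> poly q (data_size (encode x))"
      "eval (shift 1 e # map (shift 1) p) [encode x] (shift 1 e) (eb (f x)) n"
      using computesD(2)[OF * x] by blast
    then show ?thesis
      using eval_Call[OF eval_Var0, of 0 "shift 1 e # map (shift 1) p"] assms(2)[OF x]
      by (intro exI[of _ "eb (f x)"] exI[of _ "Suc (1 + n)"]) simp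
  qed
  then show ?thesis unfolding polynomial_time_solvable_def by blast
qed

section \<open>The variable-sized robust problem as an envelope problem\<close>

context st_dag
begin

lemma worst_case_eq:
  assumes P: "P \<in> walks G s t" and lam: "lam \<ge> 0" and d: "\<forall>e\<in>arcs G. 0 \<le> d e"
  shows "worst_case c (interval_box G d) lam P = lin lam (objective c d P)"
proof -
  have PA: "set P \<subseteq> arcs G" using P by (auto simp: walks_def awalk_def)
  have eq: "lin lam (objective c d P) = (\<Sum>e\<leftarrow>P. c e + lam * d e)"
    by (simp add: lin_def objective_def path_weight_def sum_list_addf sum_list_const_mult)
  show ?thesis
    unfolding worst_case_def
  proof (rule cSup_eq_maximum)
    \<comment> \<open>All arcs attain their worst deviation simultaneously. The restriction is
      needed because members of the box are \<open>undefined\<close> outside the arcs.\<close>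
    let ?b = "restrict d (arcs G)"
    have "?b \<in> interval_box G d" using d by (force simp: interval_box_def)
    then have mem: "(\<lambda>e. c e + lam * ?b e) \<in> uncertainty_set c (interval_box G d) lam"
      unfolding uncertainty_set_def by blast
    have val: "path_weight (\<lambda>e. c e + lam * ?b e) P = lin lam (objective c d P)"
      unfolding eq path_weight_def using PA by (intro arg_cong[of _ _ sum_list] map_cong) auto
    show "lin lam (objective c d P) \<in> (\<lambda>c'. path_weight c' P) ` uncertainty_set c (interval_box G d) lam"
      by (rule rev_image_eqI[OF mem]) (rule val[symmetric])
  next
    fix x assume "x \<in> (\<lambda>c'. path_weight c' P) ` uncertainty_set c (interval_box G d) lam"
    then obtain b where b: "b \<in> interval_box G d" "x = (\<Sum>e\<leftarrow>P. c e + lam * b e)"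
      by (auto simp: uncertainty_set_def path_weight_def)
    have "b e \<le> d e" if "e \<in> set P" for e
      using b(1) that PA by (auto simp: interval_box_def PiE_iff)
    then show "x \<le> lin lam (objective c d P)"
      unfolding eq b(2) by (intro sum_list_mono) (simp add: lam mult_left_mono)
  qed
qed

lemma robust_optimal_iff:
  assumes "lam \<ge> 0" "\<forall>e\<in>arcs G. 0 \<le> d e" "P \<in> walks G s t"
  shows "robust_optimal G s t c (interval_box G d) lam P
    \<longleftrightarrow> minimizer (costs c d G s t) lam (objective c d P)"
proof -
  have wc: "worst_case c (interval_box G d) lam Q = lin lam (objective c d Q)" if "Q \<in> walks G s t" for Q
    using worst_case_eq[OF that assms(1,2)] .
  have "robust_optimal G s t c (interval_box G d) lam P \<longleftrightarrow>
      (\<forall>Q\<in>walks G s t. \<not> worst_case c (interval_box G d) lam Q < worst_case c (interval_box G d) lam P)"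
    using assms(3) by (auto simp: robust_optimal_def is_arg_min_def walks_eq_st_paths)
  also have "\<dots> \<longleftrightarrow> (\<forall>Q\<in>walks G s t. lin lam (objective c d P) \<le> lin lam (objective c d Q))"
    using wc assms(3) by (simp add: not_less)
  also have "\<dots> \<longleftrightarrow> minimizer (costs c d G s t) lam (objective c d P)"
    using assms(3) by (auto simp: minimizer_def costs_def)
  finally show ?thesis .
qed

text \<open>The cost vectors of any covering family contain the whole envelope by
  \<open>envelope_subset_covers\<close>; one path per point of the envelope attains this
  number.\<close>

lemma variable_sized_solutionI:
  assumes d: "\<forall>e\<in>arcs G. 0 \<le> d e" and ne: "walks G s t \<noteq> {}"
    and S: "S \<subseteq> walks G s t" "inj_on (objective c d) S" "objective c d ` S = envelope (costs c d G s t)"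
  shows "variable_sized_solution G s t c (interval_box G d) S"
proof -
  have iff: "covers_all_sizes G s t c (interval_box G d) S' \<longleftrightarrow>
      S' \<subseteq> walks G s t \<and> covers (costs c d G s t) (objective c d ` S')" for S'
  proof (cases "S' \<subseteq> walks G s t")
    case True
    then have "objective c d ` S' \<subseteq> costs c d G s t" by (auto simp: costs_def)
    moreover have "(\<exists>P\<in>S'. robust_optimal G s t c (interval_box G d) lam P) \<longleftrightarrow>
        (\<exists>a\<in>objective c d ` S'. minimizer (costs c d G s t) lam a)" if "lam \<ge> 0" for lam
      using robust_optimal_iff[OF that d] True by blast
    ultimately show ?thesis using True
      by (simp add: covers_all_sizes_def covers_def walks_eq_st_paths[symmetric])
  qed (simp add: covers_all_sizes_def walks_eq_st_paths)
  have "costs c d G s t \<noteq> {}" using ne by (simp add: costs_def)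
  then have "covers_all_sizes G s t c (interval_box G d) S"
    unfolding iff S(3) using S(1) envelope_covers[OF finite_costs] by blast
  moreover have "card S \<le> card S'" if "covers_all_sizes G s t c (interval_box G d) S'" for S'
  proof -
    have S': "S' \<subseteq> walks G s t" "covers (costs c d G s t) (objective c d ` S')" using that iff by auto
    then have fin: "finite S'" using finite_walks finite_subset unfolding walks_def by blast
    have "card S = card (envelope (costs c d G s t))" using card_image[OF S(2)] S(3) by simp
    also have "\<dots> \<le> card (objective c d ` S')"
      using fin envelope_subset_covers[OF S'(2)] by (intro card_mono) auto
    also have "\<dots> \<le> card S'" using fin by (rule card_image_le)
    finally show ?thesis .
  qed
  ultimately show ?thesis by (auto simp: variable_sized_solution_def is_arg_min_def not_less)
qed

end

section \<open>The algorithm\<close>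

type_synonym frac = "int \<times> int"

text \<open>Fractions are never reduced, as the machine has no division. Denominators stay positive,
  which suffices for comparison by cross-multiplication.\<close>

definition fadd :: "frac \<Rightarrow> frac \<Rightarrow> frac" where
  "fadd x y = (fst x * snd y + fst y * snd x, snd x * snd y)"

definition fsub :: "frac \<Rightarrow> frac \<Rightarrow> frac" where
  "fsub x y = (fst x * snd y - fst y * snd x, snd x * snd y)"

definition fmul :: "frac \<Rightarrow> frac \<Rightarrow> frac" where
  "fmul x y = (fst x * fst y, snd x * snd y)"

definition fle :: "frac \<Rightarrow> frac \<Rightarrow> bool" where
  "fle x y \<longleftrightarrow> fst x * snd y \<le> fst y * snd x"

definition fsum :: "frac list \<Rightarrow> frac" where
  "fsum xs = fold (\<lambda>x s. fadd s x) xs (0, 1)"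

definition fpos :: "frac \<Rightarrow> bool" where
  "fpos x \<longleftrightarrow> snd x > 0"

definition fval :: "frac \<Rightarrow> real" where
  "fval x = of_int (fst x) / of_int (snd x)"

lemma fpos_ops: "fpos x \<Longrightarrow> fpos y \<Longrightarrow> fpos (fadd x y) \<and> fpos (fsub x y) \<and> fpos (fmul x y)"
  by (simp add: fpos_def fadd_def fsub_def fmul_def)

lemma fval_ops:
  assumes "fpos x" "fpos y"
  shows "fval (fadd x y) = fval x + fval y" "fval (fsub x y) = fval x - fval y"
    "fval (fmul x y) = fval x * fval y" "fle x y \<longleftrightarrow> fval x \<le> fval y"
proof -
  have pos: "real_of_int (snd x) > 0" "real_of_int (snd y) > 0" using assms by (auto simp: fpos_def)
  show "fval (fadd x y) = fval x + fval y" "fval (fsub x y) = fval x - fval y"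
    "fval (fmul x y) = fval x * fval y"
    using pos by (simp_all add: fval_def fadd_def fsub_def fmul_def field_simps)
  have "fle x y \<longleftrightarrow> real_of_int (fst x * snd y) \<le> real_of_int (fst y * snd x)"
    unfolding fle_def by (simp only: of_int_le_iff)
  also have "\<dots> \<longleftrightarrow> fval x \<le> fval y" using pos by (simp add: fval_def field_simps)
  finally show "fle x y \<longleftrightarrow> fval x \<le> fval y" .
qed

lemma fsum_correct:
  assumes "\<And>x. x \<in> set xs \<Longrightarrow> fpos x"
  shows "fpos (fsum xs) \<and> fval (fsum xs) = (\<Sum>x\<leftarrow>xs. fval x)"
proof -
  have "fpos (fold (\<lambda>x s. fadd s x) xs a) \<and> fval (fold (\<lambda>x s. fadd s x) xs a) = fval a + (\<Sum>x\<leftarrow>xs. fval x)"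
    if "fpos a" for a
    using assms that by (induction xs arbitrary: a) (auto simp: fpos_ops fval_ops)
  from this[of "(0, 1)"] show ?thesis by (simp add: fsum_def fpos_def fval_def)
qed

text \<open>An arc is stored with its index, tail, head and its two weights; the unit component stems from
  the encoding of the weights as the end of a list.\<close>

type_synonym arc = "nat \<times> nat \<times> nat \<times> frac \<times> frac \<times> unit"

section \<open>Labels, pruning and the dynamic program\<close>

type_synonym label = "nat \<times> arc list"

abbreviation "aidx (a :: arc) \<equiv> fst a"
abbreviation "atail (a :: arc) \<equiv> fst (snd a)"
abbreviation "ahead (a :: arc) \<equiv> fst (snd (snd a))"
abbreviation "acost (a :: arc) \<equiv> fst (snd (snd (snd a)))"
abbreviation "adev (a :: arc) \<equiv> fst (snd (snd (snd (snd a))))"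

text \<open>Costs are recomputed from the path instead of being stored, so the size of a label is
  unaffected by the growth of fractions.\<close>

definition lcost :: "label \<Rightarrow> frac \<times> frac" where
  "lcost l = (fsum (map acost (snd l)), fsum (map adev (snd l)))"

definition cle :: "frac \<times> frac \<Rightarrow> frac \<times> frac \<Rightarrow> bool" where
  "cle a b \<longleftrightarrow> fle (fst a) (fst b) \<and> fle (snd a) (snd b)"

text \<open>A pair of competitors that violates \<open>supported\<close>: \<open>b\<close> dominates
  \<open>a\<close>, or the segment from \<open>b\<close> to \<open>b'\<close> passes on or below
  \<open>a\<close>.\<close>

definition refutes :: "frac \<times> frac \<Rightarrow> frac \<times> frac \<Rightarrow> frac \<times> frac \<Rightarrow> bool" where
  "refutes a b b' \<longleftrightarrow> (cle b a \<and> \<not> cle a b) \<or>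
     (\<not> fle (fst a) (fst b) \<and> \<not> fle (snd a) (snd b') \<and>
      fle (fmul (fsub (fst b') (fst a)) (fsub (snd b) (snd a)))
          (fmul (fsub (fst a) (fst b)) (fsub (snd a) (snd b'))))"

definition keep :: "label list \<Rightarrow> label \<Rightarrow> bool" where
  "keep ls l \<longleftrightarrow> list_all (\<lambda>x. list_all (\<lambda>y. \<not> refutes (lcost l) (lcost x) (lcost y)) ls) ls"

definition dedup :: "label list \<Rightarrow> label list" where
  "dedup ls = fold (\<lambda>l acc. if list_ex (\<lambda>x. cle (lcost x) (lcost l) \<and> cle (lcost l) (lcost x)) acc
     then acc else l # acc) ls []"

definition prune :: "label list \<Rightarrow> label list" where
  "prune ls = dedup (filter (keep ls) ls)"

definition labelled :: "label list \<Rightarrow> nat \<Rightarrow> bool" where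
  "labelled st v \<longleftrightarrow> list_ex (\<lambda>l. fst l = v) st"

definition ready :: "arc list \<Rightarrow> label list \<Rightarrow> nat \<Rightarrow> bool" where
  "ready as st v \<longleftrightarrow> list_all (\<lambda>a. \<not> atail a = v \<or> labelled st (ahead a)) as"

definition candidates :: "arc list \<Rightarrow> label list \<Rightarrow> nat \<Rightarrow> label list" where
  "candidates as st v = concat (map (\<lambda>a. map (\<lambda>l. (v, a # snd l)) (filter (\<lambda>l. fst l = ahead a) st))
     (filter (\<lambda>a. atail a = v) as))"

text \<open>Nodes are visited through their outgoing arcs. A node is labelled once, when all its
  successors are complete; otherwise it waits for a later round, so no topological order has to be
  computed.\<close>

definition dp_step :: "arc list \<Rightarrow> arc \<Rightarrow> label list \<Rightarrow> label list" where
  "dp_step as e st = (if \<not> labelled st (atail e) \<and> ready as st (atail e)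
     then prune (candidates as st (atail e)) @ st else st)"

text \<open>The rounds, one for each arc, are flattened into a single list, so that one bounded
  recursion covers them all.\<close>

definition dp_run :: "arc list \<Rightarrow> nat \<Rightarrow> label list" where
  "dp_run as t = fold (dp_step as) (concat (map (\<lambda>_. as) as)) [(t, [])]"

definition paths_at :: "nat \<Rightarrow> label list \<Rightarrow> nat list list" where
  "paths_at v st = map (\<lambda>l. map aidx (snd l)) (filter (\<lambda>l. fst l = v) st)"

text \<open>The instance encoding identifies arcs by position only; the numbers required in the
  output are recovered here.\<close>

definition enumerate_arcs :: "(nat \<times> nat \<times> frac \<times> frac \<times> unit) list \<Rightarrow> arc list" where
  "enumerate_arcs rs = snd (fold (\<lambda>r s. (Suc (fst s), (fst s, r) # snd s)) rs (0, []))"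

text \<open>Relates a list of arcs to the graph. Series-parallelness enters through acyclicity and
  the size bounds, so the analysis of the algorithm never refers to a decomposition.\<close>

locale dp = st_dag G s t for G :: "(nat, nat) pre_digraph" and s t +
  fixes c d :: "nat \<Rightarrow> real" and as :: "arc list"
  assumes as: "distinct as" "inj_on aidx (set as)" "aidx ` set as = arcs G"
    and arc: "\<And>a. a \<in> set as \<Longrightarrow> atail a = tail G (aidx a) \<and> ahead a = head G (aidx a) \<and>
      fpos (acost a) \<and> fpos (adev a) \<and> fval (acost a) = c (aidx a) \<and> fval (adev a) = d (aidx a)"
    and card_verts: "card (verts G) \<le> length as + 1"
    and walks_nonempty: "\<And>v. v \<in> verts G \<Longrightarrow> walks G v t \<noteq> {}"
    and card_envelope: "\<And>v. v \<in> verts G \<Longrightarrow> card (envelope (costs c d G v t)) \<le> length as"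
begin

section \<open>Correctness of pruning and of the label updates\<close>

definition rcost :: "label \<Rightarrow> real \<times> real" where
  "rcost l = objective c d (map aidx (snd l))"

lemma lcost_correct:
  assumes "set (snd l) \<subseteq> set as"
  shows "fpos (fst (lcost l))" "fpos (snd (lcost l))"
    "fval (fst (lcost l)) = fst (rcost l)" "fval (snd (lcost l)) = snd (rcost l)"
proof -
  have 1: "fpos (fsum (map acost (snd l))) \<and> fval (fsum (map acost (snd l))) = (\<Sum>x\<leftarrow>map acost (snd l). fval x)"
    using assms arc by (intro fsum_correct) auto
  have 2: "fpos (fsum (map adev (snd l))) \<and> fval (fsum (map adev (snd l))) = (\<Sum>x\<leftarrow>map adev (snd l). fval x)"
    using assms arc by (intro fsum_correct) auto
  have "fval (acost a) = c (aidx a) \<and> fval (adev a) = d (aidx a)" if "a \<in> set (snd l)" for a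
    using that assms arc[of a] by blast
  then have "sum_list (map (fval \<circ> acost) (snd l)) = sum_list (map (c \<circ> aidx) (snd l))"
    "sum_list (map (fval \<circ> adev) (snd l)) = sum_list (map (d \<circ> aidx) (snd l))"
    by (intro arg_cong[of _ _ sum_list] map_cong refl; simp)+
  then show "fpos (fst (lcost l))" "fpos (snd (lcost l))"
    "fval (fst (lcost l)) = fst (rcost l)" "fval (snd (lcost l)) = snd (rcost l)"
    using 1 2 by (simp_all add: lcost_def rcost_def objective_def path_weight_def)
qed

lemma cle_iff:
  assumes "set (snd l) \<subseteq> set as" "set (snd l') \<subseteq> set as"
  shows "cle (lcost l) (lcost l') \<longleftrightarrow> fst (rcost l) \<le> fst (rcost l') \<and> snd (rcost l) \<le> snd (rcost l')"
  using lcost_correct[OF assms(1)] lcost_correct[OF assms(2)] by (simp add: cle_def fval_ops)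

lemma keep_iff:
  assumes ls: "\<And>l. l \<in> set ls \<Longrightarrow> set (snd l) \<subseteq> set as" and "l \<in> set ls"
  shows "keep ls l \<longleftrightarrow> supported (rcost ` set ls) (rcost l)"
proof -
  \<comment> \<open>The domination clause is repeated for each \<open>y\<close>; as the list
    contains \<open>l\<close> and is thus nonempty, quantifying over all pairs yields
    \<open>supported\<close>.\<close>
  have *: "\<not> refutes (lcost l) (lcost x) (lcost y) \<longleftrightarrow>
     (fst (rcost x) \<le> fst (rcost l) \<longrightarrow> snd (rcost x) \<le> snd (rcost l) \<longrightarrow> rcost x = rcost l) \<and>
     (fst (rcost x) < fst (rcost l) \<longrightarrow> snd (rcost y) < snd (rcost l) \<longrightarrow>
      (fst (rcost l) - fst (rcost x)) * (snd (rcost l) - snd (rcost y))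
      < (fst (rcost y) - fst (rcost l)) * (snd (rcost x) - snd (rcost l)))"
    if "x \<in> set ls" "y \<in> set ls" for x y
    using cle_iff[OF ls ls, of l x] cle_iff[OF ls ls, of x l] that assms(2)
      lcost_correct[OF ls, of x] lcost_correct[OF ls, of y] lcost_correct[OF ls, of l]
    by (auto simp: refutes_def fval_ops fpos_ops prod_eq_iff not_le)
  show ?thesis
    unfolding keep_def supported_def list_all_iff using assms(2) by (simp add: * cong: ball_cong) blast
qed

lemma dedup_correct:
  assumes "\<And>l. l \<in> set ls \<Longrightarrow> set (snd l) \<subseteq> set as"
  shows "set (dedup ls) \<subseteq> set ls" "distinct (dedup ls)" "inj_on rcost (set (dedup ls))"
    "rcost ` set (dedup ls) = rcost ` set ls"
proof -
  have "set (dedup ls) \<subseteq> set ls \<and> distinct (dedup ls) \<and> inj_on rcost (set (dedup ls)) \<and>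
    rcost ` set (dedup ls) = rcost ` set ls"
    using assms
  proof (induction ls rule: rev_induct)
    case Nil
    then show ?case by (simp add: dedup_def)
  next
    case (snoc l ls)
    have IH: "set (dedup ls) \<subseteq> set ls" "distinct (dedup ls)" "inj_on rcost (set (dedup ls))"
      "rcost ` set (dedup ls) = rcost ` set ls" using snoc by auto
    have ok: "set (snd x) \<subseteq> set as" if "x \<in> set ls \<union> {l}" for x using snoc.prems[of x] that by auto
    have "cle (lcost x) (lcost l) \<and> cle (lcost l) (lcost x) \<longleftrightarrow> rcost l = rcost x" if "x \<in> set ls" for x
      using cle_iff[OF ok ok, of x l] cle_iff[OF ok ok, of l x] that by (auto simp: prod_eq_iff)
    then have ex: "list_ex (\<lambda>x. cle (lcost x) (lcost l) \<and> cle (lcost l) (lcost x)) (dedup ls)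
        \<longleftrightarrow> rcost l \<in> rcost ` set (dedup ls)"
      unfolding list_ex_iff image_iff using IH(1) by (intro bex_cong[OF refl]) auto
    have "dedup (ls @ [l]) = (if rcost l \<in> rcost ` set (dedup ls) then dedup ls else l # dedup ls)"
      unfolding ex[symmetric] by (simp add: dedup_def)
    then show ?case using IH by auto
  qed
  then show "set (dedup ls) \<subseteq> set ls" "distinct (dedup ls)" "inj_on rcost (set (dedup ls))"
    "rcost ` set (dedup ls) = rcost ` set ls" by auto
qed

lemma prune_correct:
  assumes "\<And>l. l \<in> set ls \<Longrightarrow> set (snd l) \<subseteq> set as"
  shows "set (prune ls) \<subseteq> set ls" "distinct (prune ls)" "inj_on rcost (set (prune ls))"
    "rcost ` set (prune ls) = envelope (rcost ` set ls)"
proof -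
  note * = dedup_correct[of "filter (keep ls) ls", folded prune_def]
  show "set (prune ls) \<subseteq> set ls" "distinct (prune ls)" "inj_on rcost (set (prune ls))"
    using * assms by auto
  have "rcost ` set (prune ls) = rcost ` {l \<in> set ls. keep ls l}" using * assms by auto
  also have "{l \<in> set ls. keep ls l} = {l \<in> set ls. rcost l \<in> envelope (rcost ` set ls)}"
  proof -
    have "keep ls l \<longleftrightarrow> rcost l \<in> envelope (rcost ` set ls)" if "l \<in> set ls" for l
      using keep_iff[OF assms that] envelope_iff_supported[of "rcost ` set ls" "rcost l"] that by simp
    then show ?thesis by blast
  qed
  also have "rcost ` \<dots> = envelope (rcost ` set ls)" using envelope_subset by blast
  finally show "rcost ` set (prune ls) = envelope (rcost ` set ls)" .
qed

definition labels_at :: "label list \<Rightarrow> nat \<Rightarrow> label set" where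
  "labels_at st v = {l \<in> set st. fst l = v}"

text \<open>A node has either no labels or a complete, irredundant set for its envelope. There are
  no partial stages, so the size bound holds after every step.\<close>

definition invar :: "label list \<Rightarrow> bool" where
  "invar st \<longleftrightarrow> distinct st \<and> labels_at st t \<noteq> {} \<and>
     (\<forall>l\<in>set st. fst l \<in> verts G \<and> set (snd l) \<subseteq> set as \<and> awalk (fst l) (map aidx (snd l)) t) \<and>
     (\<forall>v. inj_on rcost (labels_at st v)) \<and>
     (\<forall>v. labels_at st v \<noteq> {} \<longrightarrow> rcost ` labels_at st v = envelope (costs c d G v t))"

lemma invarD:
  assumes "invar st" "l \<in> labels_at st v"
  shows "v \<in> verts G" "set (snd l) \<subseteq> set as" "awalk v (map aidx (snd l)) t"
proof -
  have l: "l \<in> set st" "fst l = v" using assms(2) by (simp_all add: labels_at_def)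
  have "fst l \<in> verts G \<and> set (snd l) \<subseteq> set as \<and> awalk (fst l) (map aidx (snd l)) t"
    using assms(1) l(1) unfolding invar_def by blast
  then show "v \<in> verts G" "set (snd l) \<subseteq> set as" "awalk v (map aidx (snd l)) t"
    by (simp_all add: l(2))
qed

lemma labelled_iff: "labelled st v \<longleftrightarrow> labels_at st v \<noteq> {}"
  unfolding labelled_def list_ex_iff labels_at_def by blast

lemma set_candidates:
  "set (candidates as st v) = {(v, a # snd l) | a l. a \<in> set as \<and> atail a = v \<and> l \<in> labels_at st (ahead a)}"
proof -
  have "set (candidates as st v) =
      (\<Union>a\<in>{a \<in> set as. atail a = v}. (\<lambda>l. (v, a # snd l)) ` labels_at st (ahead a))"
    by (simp add: candidates_def labels_at_def)
  then show ?thesis by blast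
qed

lemma aidx_in_arcs: "a \<in> set as \<Longrightarrow> aidx a \<in> arcs G"
  using as(3) by blast

lemma obtain_arc:
  assumes "i \<in> arcs G"
  obtains a where "a \<in> set as" "aidx a = i" "atail a = tail G i" "ahead a = head G i"
proof -
  from assms obtain a where a: "a \<in> set as" "i = aidx a" unfolding as(3)[symmetric] by (rule imageE)
  then show ?thesis using that[OF a(1)] arc[OF a(1)] by simp
qed

lemma rcost_Cons: "a \<in> set as \<Longrightarrow> rcost (v, a # p) = (c (aidx a), d (aidx a)) + rcost (w, p)"
  by (simp add: rcost_def objective_Cons)

lemma envelope_costs_covers:
  assumes "v \<in> verts G"
  shows "covers (costs c d G v t) (envelope (costs c d G v t))"
  using walks_nonempty[OF assms] by (intro envelope_covers finite_costs) (simp add: costs_def)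

lemma coversD: "covers A C \<Longrightarrow> l \<ge> 0 \<Longrightarrow> \<exists>a\<in>C. minimizer A l a"
  by (simp add: covers_def)

text \<open>Principle of optimality for each fixed weight: after the first arc of an optimal walk,
  the rest may be replaced by a label at the head of that arc that is optimal for the same weight.
  Pruned successors suffice for this, although their extensions need not attain all costs at
  \<open>v\<close>.\<close>

lemma candidates_cover:
  assumes inv: "invar st" and v: "v \<in> verts G" "v \<noteq> t" and ready: "ready as st v"
  shows "covers (costs c d G v t) (rcost ` set (candidates as st v))"
proof -
  have head: "rcost ` labels_at st (ahead a) = envelope (costs c d G (ahead a) t)"
    "ahead a \<in> verts G" if a: "a \<in> set as" "atail a = v" for a
  proof -
    have "labelled st (ahead a)" using ready a unfolding ready_def list_all_iff by blast
    then show "rcost ` labels_at st (ahead a) = envelope (costs c d G (ahead a) t)"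
      using inv unfolding labelled_iff invar_def by blast
    show "ahead a \<in> verts G" using arc[OF a(1)] aidx_in_arcs[OF a(1)] by simp
  qed
  have sub: "rcost ` set (candidates as st v) \<subseteq> costs c d G v t"
  proof
    fix x assume "x \<in> rcost ` set (candidates as st v)"
    then obtain a l where al: "x = rcost (v, a # snd l)" "a \<in> set as" "atail a = v" "l \<in> labels_at st (ahead a)"
      unfolding set_candidates by blast
    have "awalk (ahead a) (map aidx (snd l)) t"
      using invarD(3)[OF inv al(4)] .
    then have "awalk v (map aidx (a # snd l)) t"
      using al(3) arc[OF al(2)] aidx_in_arcs[OF al(2)] by (simp add: awalk_Cons_iff)
    then show "x \<in> costs c d G v t" unfolding al(1) by (simp add: costs_def walks_def rcost_def)
  qed
  moreover have "\<exists>a\<in>rcost ` set (candidates as st v). minimizer (costs c d G v t) lam a" if lam: "lam \<ge> 0" for lam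
  proof -
    obtain x where x: "minimizer (costs c d G v t) lam x"
      using coversD[OF envelope_costs_covers[OF v(1)] lam] by blast
    then obtain p where p: "awalk v p t" "x = objective c d p"
      unfolding minimizer_def costs_def walks_def by blast
    then obtain i p' where ip: "p = i # p'" using v(2) by (cases p) (auto simp: awalk_Nil_iff)
    then have i: "i \<in> arcs G" "tail G i = v" "awalk (head G i) p' t" using p(1) by (auto simp: awalk_Cons_iff)
    obtain a where a: "a \<in> set as" "aidx a = i" "atail a = tail G i" "ahead a = head G i"
      using obtain_arc[OF i(1)] .
    have av: "atail a = v" using a(3) i(2) by simp
    have "covers (costs c d G (ahead a) t) (rcost ` labels_at st (ahead a))"
      using envelope_costs_covers[OF head(2)[OF a(1) av]] unfolding head(1)[OF a(1) av] .
    from coversD[OF this lam] obtain l where l: "l \<in> labels_at st (ahead a)"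
      "minimizer (costs c d G (ahead a) t) lam (rcost l)" by blast
    have "objective c d p' \<in> costs c d G (ahead a) t" using i(3) a(4) by (simp add: costs_def walks_def)
    then have "lin lam (rcost l) \<le> lin lam (objective c d p')" using l(2) by (simp add: minimizer_def)
    then have le: "lin lam (rcost (v, a # snd l)) \<le> lin lam x"
      unfolding p(2) ip using rcost_Cons[OF a(1), of v "snd l" "fst l"] a(2)
      by (simp add: objective_Cons lin_add)
    have mem: "rcost (v, a # snd l) \<in> rcost ` set (candidates as st v)"
      unfolding set_candidates using a(1) av l(1) by blast
    then have "minimizer (costs c d G v t) lam (rcost (v, a # snd l))"
      using sub x le unfolding minimizer_def by (meson order_trans subsetD)
    then show ?thesis using mem by blast
  qed
  ultimately show ?thesis by (auto simp: covers_def)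
qed

lemma dp_step_new:
  assumes inv: "invar st" and e: "e \<in> set as" and new: "\<not> labelled st (atail e)" "ready as st (atail e)"
  defines "ls \<equiv> prune (candidates as st (atail e))"
  shows "distinct ls" "inj_on rcost (set ls)" "rcost ` set ls = envelope (costs c d G (atail e) t)" "ls \<noteq> []"
    "\<And>l. l \<in> set ls \<Longrightarrow> fst l = atail e \<and> set (snd l) \<subseteq> set as \<and> awalk (fst l) (map aidx (snd l)) t"
proof -
  have v: "atail e \<in> verts G" using arc[OF e] aidx_in_arcs[OF e] by simp
  have "atail e \<noteq> t" using new inv by (auto simp: labelled_iff invar_def)
  note cov = candidates_cover[OF inv v this new(2)]
  have cand: "fst l = atail e \<and> set (snd l) \<subseteq> set as \<and> awalk (fst l) (map aidx (snd l)) t"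
    if l: "l \<in> set (candidates as st (atail e))" for l
  proof -
    obtain a l' where "l = (atail e, a # snd l')" "a \<in> set as" "atail a = atail e" "l' \<in> labels_at st (ahead a)"
      using l unfolding set_candidates by blast
    moreover from this have "set (snd l') \<subseteq> set as" "awalk (ahead a) (map aidx (snd l')) t"
      using invarD(2,3)[OF inv] by blast+
    ultimately show ?thesis using arc[of a] aidx_in_arcs[of a] by (simp add: awalk_Cons_iff)
  qed
  note pr = prune_correct[of "candidates as st (atail e)", folded ls_def]
  show "distinct ls" "inj_on rcost (set ls)" using pr cand by auto
  show eq: "rcost ` set ls = envelope (costs c d G (atail e) t)"
    using pr(4) cand envelope_covers_eq[OF cov] by simp
  have "envelope (costs c d G (atail e) t) \<noteq> {}"
    using coversD[OF envelope_costs_covers[OF v], of 0] by blast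
  then show "ls \<noteq> []" using eq by auto
  show "fst l = atail e \<and> set (snd l) \<subseteq> set as \<and> awalk (fst l) (map aidx (snd l)) t" if "l \<in> set ls" for l
    using pr(1) cand that by blast
qed

lemma labelled_dp_step:
  assumes "invar st" "e \<in> set as"
  shows "labelled (dp_step as e st) v \<longleftrightarrow> labelled st v \<or> (v = atail e \<and> ready as st v)"
proof (cases "\<not> labelled st (atail e) \<and> ready as st (atail e)")
  case True
  note new = dp_step_new[OF assms conjunct1[OF True] conjunct2[OF True]]
  have "labelled (dp_step as e st) v \<longleftrightarrow> labelled (prune (candidates as st (atail e))) v \<or> labelled st v"
    using True by (simp add: dp_step_def labelled_def)
  moreover have "labelled (prune (candidates as st (atail e))) v \<longleftrightarrow> v = atail e"
  proof
    assume "v = atail e"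
    moreover have "hd (prune (candidates as st (atail e))) \<in> set (prune (candidates as st (atail e)))"
      using new(4) by simp
    ultimately show "labelled (prune (candidates as st (atail e))) v"
      using new(5) unfolding labelled_def list_ex_iff by blast
  qed (use new(5) in \<open>unfold labelled_def list_ex_iff, blast\<close>)
  ultimately show ?thesis using True by auto
qed (auto simp: dp_step_def)

lemma invar_dp_step:
  assumes inv: "invar st" and e: "e \<in> set as"
  shows "invar (dp_step as e st)"
proof (cases "\<not> labelled st (atail e) \<and> ready as st (atail e)")
  case True
  note new = dp_step_new[OF assms conjunct1[OF True] conjunct2[OF True]]
  define ls where "ls = prune (candidates as st (atail e))"
  note new = new[folded ls_def]
  have st: "dp_step as e st = ls @ st" using True by (simp add: dp_step_def ls_def)
  have at: "labels_at (ls @ st) v = (if v = atail e then set ls else labels_at st v)" for v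
    using new(5) True by (auto simp: labels_at_def labelled_iff)
  have "set ls \<inter> set st = {}" using new(5) True by (auto simp: labelled_def list_ex_iff)
  then have "distinct (ls @ st)" using new(1) inv by (simp add: invar_def)
  moreover have ne: "labels_at st t \<noteq> {}" using inv by (simp add: invar_def)
  then have "t \<noteq> atail e" using True unfolding labelled_iff by blast
  then have "labels_at (ls @ st) t \<noteq> {}" unfolding at using ne by simp
  moreover have "fst l \<in> verts G \<and> set (snd l) \<subseteq> set as \<and> awalk (fst l) (map aidx (snd l)) t"
    if l: "l \<in> set (ls @ st)" for l
  proof (cases "l \<in> set ls")
    case True
    have "atail e \<in> verts G" using arc[OF e] aidx_in_arcs[OF e] by simp
    then show ?thesis using new(5)[OF True] by (elim conjE) simp
  next
    case False
    then have "l \<in> set st" using l by simp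
    then show ?thesis using inv unfolding invar_def by blast
  qed
  moreover have "inj_on rcost (labels_at (ls @ st) v)" for v
    unfolding at using new(2) inv by (simp add: invar_def)
  moreover have "labels_at (ls @ st) v \<noteq> {} \<longrightarrow> rcost ` labels_at (ls @ st) v = envelope (costs c d G v t)" for v
    unfolding at using new(3) inv by (simp add: invar_def)
  ultimately show ?thesis unfolding st invar_def by blast
next
  case False
  then show ?thesis using inv by (auto simp: dp_step_def)
qed

lemma invar_fold: "invar st \<Longrightarrow> set es \<subseteq> set as \<Longrightarrow> invar (fold (dp_step as) es st)"
  by (induction es arbitrary: st) (auto simp: invar_dp_step)

lemma labelled_fold:
  "invar st \<Longrightarrow> set es \<subseteq> set as \<Longrightarrow> labelled st v \<Longrightarrow> labelled (fold (dp_step as) es st) v"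
  by (induction es arbitrary: st) (auto simp: invar_dp_step labelled_dp_step)

lemma invar_init: "invar [(t, [])]"
proof -
  have "costs c d G t t = {0}" by (simp add: costs_def walks_t objective_Nil)
  moreover have "envelope {0} = {0}"
    using envelope_covers[of "{0}"] envelope_subset[of "{0}"] by (force simp: covers_def)
  moreover have "labels_at [(t, [])] v = (if v = t then {(t, [])} else {})" for v
    by (auto simp: labels_at_def)
  ultimately show ?thesis
    using t_in_verts by (auto simp: invar_def rcost_def objective_Nil awalk_Nil_iff)
qed

section \<open>Number of rounds and number of labels\<close>

definition labelled_verts :: "label list \<Rightarrow> nat set" where
  "labelled_verts st = {v \<in> verts G. labelled st v}"

text \<open>An unlabelled node of greatest potential has only labelled successors, so one pass over
  the arcs labels it, at the latest when one of its outgoing arcs is met.\<close>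

lemma round_progress:
  assumes inv: "invar st" and "labelled_verts st \<noteq> verts G"
  shows "card (labelled_verts (fold (dp_step as) as st)) > card (labelled_verts st)"
proof -
  obtain pot :: "nat \<Rightarrow> real" where pot: "\<And>e. e \<in> arcs G \<Longrightarrow> pot (tail G e) < pot (head G e)"
    using ex_potential by blast
  define U where "U = verts G - labelled_verts st"
  have "finite U" "U \<noteq> {}" using assms(2) by (auto simp: U_def labelled_verts_def)
  then obtain u where u: "u \<in> U" "\<And>w. w \<in> U \<Longrightarrow> pot w \<le> pot u"
    using arg_min_if_finite[of U "\<lambda>w. - pot w"] by (metis neg_less_iff_less not_le)
  have rd: "labelled st (ahead a)" if a: "a \<in> set as" "atail a = u" for a
  proof (rule ccontr)
    have "aidx a \<in> arcs G" using aidx_in_arcs a by blast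
    assume "\<not> labelled st (ahead a)"
    then have "ahead a \<in> U"
      using arc[OF a(1)] \<open>aidx a \<in> arcs G\<close> by (auto simp: U_def labelled_verts_def)
    then show False using u(2)[of "ahead a"] pot[OF \<open>aidx a \<in> arcs G\<close>] arc[OF a(1)] a(2) by simp
  qed
  have "u \<noteq> t" using u(1) inv by (auto simp: U_def labelled_verts_def labelled_iff invar_def)
  then obtain i where "i \<in> arcs G" "tail G i = u" using out_arc[of u] u(1) by (auto simp: U_def)
  then obtain a where a: "a \<in> set as" "atail a = u" using obtain_arc by metis
  \<comment> \<open>Labels are never removed, so the node is still ready when the pass reaches this
    arc.\<close>
  obtain xs ys where split: "as = xs @ a # ys" using split_list[OF a(1)] by blast
  define st' where "st' = fold (dp_step as) xs st"
  have sub: "set xs \<subseteq> set as" "set ys \<subseteq> set as" using split by auto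
  have inv': "invar st'" unfolding st'_def using invar_fold[OF inv sub(1)] .
  have mono: "labelled st' v" if "labelled st v" for v
    unfolding st'_def using labelled_fold[OF inv sub(1) that] .
  have "ready as st' u" using rd mono by (auto simp: ready_def list_all_iff)
  then have "labelled (dp_step as a st') u" using labelled_dp_step[OF inv' a(1)] a(2) by simp
  then have "labelled (fold (dp_step as) ys (dp_step as a st')) u"
    using labelled_fold[OF invar_dp_step[OF inv' a(1)] sub(2)] by simp
  moreover have "fold (dp_step as) as st = fold (dp_step as) ys (dp_step as a st')"
  proof -
    have "fold (dp_step as) (xs @ a # ys) st = fold (dp_step as) ys (dp_step as a st')"
      by (simp add: st'_def)
    then show ?thesis using split by simp
  qed
  ultimately have "u \<in> labelled_verts (fold (dp_step as) as st)" using u(1) by (simp add: labelled_verts_def U_def)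
  moreover have "u \<notin> labelled_verts st" using u(1) by (simp add: U_def)
  moreover have "labelled_verts st \<subseteq> labelled_verts (fold (dp_step as) as st)"
    using labelled_fold[OF inv, of as] by (auto simp: labelled_verts_def)
  ultimately show ?thesis by (intro psubset_card_mono) (auto simp: labelled_verts_def)
qed

text \<open>The summand 1 is a node labelled initially; each round adds another until all are
  labelled. With at most one node more than arcs, as many rounds as arcs suffice.\<close>

lemma rounds:
  assumes "invar st" "labelled_verts st \<noteq> {}"
  shows "card (labelled_verts (fold (dp_step as) (concat (map (\<lambda>_. as) xs)) st)) \<ge> min (card (verts G)) (length xs + 1)"
  using assms
proof (induction xs arbitrary: st rule: rev_induct)
  case Nil
  have "finite (labelled_verts st)" by (simp add: labelled_verts_def)
  then show ?case using Nil(2) by (simp add: Suc_le_eq card_gt_0_iff min_le_iff_disj)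
next
  case (snoc x xs)
  define st' where "st' = fold (dp_step as) (concat (map (\<lambda>_. as) xs)) st"
  have inv: "invar st'" unfolding st'_def by (rule invar_fold[OF snoc.prems(1)]) auto
  have IH: "card (labelled_verts st') \<ge> min (card (verts G)) (length xs + 1)"
    unfolding st'_def by (rule snoc.IH[OF snoc.prems])
  have eq: "fold (dp_step as) (concat (map (\<lambda>_. as) (xs @ [x]))) st = fold (dp_step as) as st'"
    by (simp add: st'_def)
  show ?case
  proof (cases "labelled_verts st' = verts G")
    case True
    have "labelled_verts (fold (dp_step as) as st') = verts G"
      using True labelled_fold[OF inv, of as] by (auto simp: labelled_verts_def)
    then show ?thesis unfolding eq by simp
  next
    case False
    then show ?thesis unfolding eq using round_progress[OF inv False] IH by auto
  qed
qed

lemma dp_run_correct: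
  shows "invar (dp_run as t)" "v \<in> verts G \<Longrightarrow> labels_at (dp_run as t) v \<noteq> {}"
proof -
  show "invar (dp_run as t)" unfolding dp_run_def by (rule invar_fold[OF invar_init]) auto
  have "labelled_verts [(t, [])] \<noteq> {}" using t_in_verts by (auto simp: labelled_verts_def labelled_def)
  from rounds[OF invar_init this, of as] have "card (labelled_verts (dp_run as t)) \<ge> card (verts G)"
    using card_verts by (simp add: dp_run_def)
  then have "labelled_verts (dp_run as t) = verts G"
    by (intro card_subset_eq) (auto simp: labelled_verts_def intro!: le_antisym card_mono)
  then show "v \<in> verts G \<Longrightarrow> labels_at (dp_run as t) v \<noteq> {}"
    by (auto simp: labelled_verts_def labelled_iff)
qed

lemma paths_at_correct:
  assumes d: "\<forall>e\<in>arcs G. 0 \<le> d e"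
  shows "distinct (paths_at s (dp_run as t))"
    "variable_sized_solution G s t c (interval_box G d) (set (paths_at s (dp_run as t)))"
proof -
  define st where "st = dp_run as t"
  define g where "g l = map aidx (snd l)" for l :: label
  have inv: "invar st" and ne: "labels_at st s \<noteq> {}" using dp_run_correct s_in_verts by (auto simp: st_def)
  have paths: "paths_at s st = map g (filter (\<lambda>l. fst l = s) st)" by (simp add: paths_at_def g_def)
  then have set_paths: "set (paths_at s st) = g ` labels_at st s" by (auto simp: labels_at_def)
  have rcost_g: "rcost l = objective c d (g l)" for l by (simp add: rcost_def g_def)
  have inj: "inj_on rcost (labels_at st s)" using inv by (simp add: invar_def)
  have "inj_on g (labels_at st s)" using inj unfolding inj_on_def rcost_g by metis
  moreover have "distinct st" using inv by (simp add: invar_def)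
  ultimately show "distinct (paths_at s (dp_run as t))"
    unfolding st_def[symmetric] paths by (simp add: distinct_map labels_at_def)
  show "variable_sized_solution G s t c (interval_box G d) (set (paths_at s (dp_run as t)))"
    unfolding st_def[symmetric] set_paths
  proof (rule variable_sized_solutionI[OF d])
    show "g ` labels_at st s \<subseteq> walks G s t" using invarD(3)[OF inv] unfolding walks_def g_def by blast
    show "inj_on (objective c d) (g ` labels_at st s)"
      using inj unfolding inj_on_def rcost_g by auto
    show "objective c d ` g ` labels_at st s = envelope (costs c d G s t)"
      using inv ne unfolding image_image rcost_g[symmetric] by (simp add: invar_def)
  qed (use walks_nonempty s_in_verts in auto)
qed

text \<open>There is at most one node more than arcs, and each has at most as many labels as there
  are arcs. The second estimate is where the series-parallel structure keeps the number of labels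
  polynomial.\<close>

lemma length_state:
  assumes inv: "invar st"
  shows "length st \<le> (length as + 1) * length as"
proof -
  have "set st = (\<Union>v\<in>verts G. labels_at st v)" using inv unfolding labels_at_def invar_def by blast
  then have "card (set st) \<le> (\<Sum>v\<in>verts G. card (labels_at st v))" by (simp add: card_UN_le)
  also have "\<dots> \<le> (\<Sum>v\<in>verts G. length as)"
  proof (rule sum_mono)
    fix v assume v: "v \<in> verts G"
    show "card (labels_at st v) \<le> length as"
    proof (cases "labels_at st v = {}")
      case False
      then have "card (labels_at st v) = card (envelope (costs c d G v t))"
        using inv card_image[of rcost "labels_at st v"] by (simp add: invar_def)
      then show ?thesis using card_envelope[OF v] by simp
    qed simp
  qed
  also have "\<dots> = card (verts G) * length as" by simp
  also have "\<dots> \<le> (length as + 1) * length as" using card_verts by (rule mult_le_mono1)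
  finally show ?thesis using inv by (simp add: invar_def distinct_card)
qed

text \<open>The tails along a walk are pairwise different in an acyclic graph. The encoding of a
  path is thus bounded by that of the arc list.\<close>

lemma distinct_path:
  assumes "invar st" "l \<in> set st"
  shows "distinct (snd l)"
proof -
  have "awalk (fst l) (map aidx (snd l)) t" using assms unfolding invar_def by blast
  then have "distinct (awalk_verts (fst l) (map aidx (snd l)))"
    using awalk_imp_apath by (auto simp: apath_def)
  then have "distinct (map (tail G) (map aidx (snd l)))" by (auto simp: awalk_verts_conv split: if_splits)
  then show ?thesis by (metis distinct_map)
qed

end

section \<open>Running time of the algorithm\<close>

abbreviation fracE :: "frac \<Rightarrow> data" where
  "fracE \<equiv> pairE IntD IntD"

abbreviation recE :: "nat \<times> nat \<times> frac \<times> frac \<times> unit \<Rightarrow> data" where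
  "recE \<equiv> pairE natE (pairE natE (pairE fracE (pairE fracE unitE)))"

abbreviation arcE :: "arc \<Rightarrow> data" where
  "arcE \<equiv> pairE natE (pairE natE (pairE natE (pairE fracE (pairE fracE unitE))))"

abbreviation labelE :: "label \<Rightarrow> data" where
  "labelE \<equiv> pairE natE (listE arcE)"

lemmas ptime_rules = ptime_const ptime_id ptime_fst ptime_snd ptime_Pair ptime_If
  ptime_plus ptime_minus ptime_times ptime_le ptime_not ptime_conj ptime_disj ptime_nat_eq ptime_nat_Suc
  ptime_Cons ptime_append ptime_map[rotated] ptime_filter[rotated]
  ptime_list_all[rotated] ptime_list_ex[rotated] ptime_concat_map[rotated]

section \<open>The parts of the algorithm on the machine\<close>

lemma ptime_fadd: "ptime UNIV (pairE fracE fracE) fracE (\<lambda>z. fadd (fst z) (snd z))"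
  unfolding fadd_def by (rule ptime_rules)+

lemma ptime_fsub: "ptime UNIV (pairE fracE fracE) fracE (\<lambda>z. fsub (fst z) (snd z))"
  unfolding fsub_def by (rule ptime_rules)+

lemma ptime_fmul: "ptime UNIV (pairE fracE fracE) fracE (\<lambda>z. fmul (fst z) (snd z))"
  unfolding fmul_def by (rule ptime_rules)+

lemma ptime_fle: "ptime UNIV (pairE fracE fracE) boolE (\<lambda>z. fle (fst z) (snd z))"
  unfolding fle_def by (rule ptime_rules)+

text \<open>Adding \<open>x\<close> multiplies the common bound on numerator and denominator by at
  most \<open>\<bar>fst x\<bar> + \<bar>snd x\<bar>\<close>, and the bits of this factor are paid
  for by the encoding of \<open>x\<close>. Unreduced sums therefore stay linear in the length of the
  input.\<close>

lemma fsum_bound: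
  "\<bar>fst (fsum xs)\<bar> < 2 ^ data_size (listE fracE xs) \<and> \<bar>snd (fsum xs)\<bar> < 2 ^ data_size (listE fracE xs)"
proof (induction xs rule: rev_induct)
  case Nil
  show ?case by (simp add: fsum_def)
next
  case (snoc x xs)
  define K where "K = data_size (listE fracE xs)"
  define a where "a = int_size (fst x) - 1"
  define b where "b = int_size (snd x) - 1"
  have x: "\<bar>fst x\<bar> < 2 ^ a" "\<bar>snd x\<bar> < 2 ^ b" using abs_less_int_size by (auto simp: a_def b_def)
  have "data_size (listE fracE (xs @ [x])) = K + Suc (data_size (fracE x))"
    by (simp add: K_def data_size_listE)
  then have K': "K + (a + b + 1) \<le> data_size (listE fracE (xs @ [x]))"
    by (simp add: pairE_def a_def b_def)
  have S: "\<bar>fst (fsum xs)\<bar> < 2 ^ K" "\<bar>snd (fsum xs)\<bar> < 2 ^ K" using snoc by (simp_all add: K_def)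
  have eq: "fsum (xs @ [x]) = fadd (fsum xs) x" by (simp add: fsum_def)
  have mult: "\<bar>u\<bar> * \<bar>v\<bar> \<le> 2 ^ K * \<bar>v\<bar>" if "\<bar>u\<bar> < 2 ^ K" for u v :: int
    using that by (intro mult_right_mono) auto
  have sum: "\<bar>fst x\<bar> + \<bar>snd x\<bar> < 2 ^ (a + b + 1)" by (rule abs_add_bound[OF x])
  have "\<bar>fst (fsum (xs @ [x]))\<bar> \<le> \<bar>fst (fsum xs)\<bar> * \<bar>snd x\<bar> + \<bar>snd (fsum xs)\<bar> * \<bar>fst x\<bar>"
    unfolding eq fadd_def using abs_triangle_ineq[of "fst (fsum xs) * snd x" "fst x * snd (fsum xs)"]
    by (simp add: abs_mult mult.commute)
  also have "\<dots> \<le> 2 ^ K * \<bar>snd x\<bar> + 2 ^ K * \<bar>fst x\<bar>"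
    using mult[OF S(1), of "snd x"] mult[OF S(2), of "fst x"] by linarith
  also have "\<dots> = 2 ^ K * (\<bar>fst x\<bar> + \<bar>snd x\<bar>)" by (simp add: algebra_simps)
  also have "\<dots> < 2 ^ K * 2 ^ (a + b + 1)" using sum by (intro mult_strict_left_mono) auto
  also have "\<dots> \<le> 2 ^ data_size (listE fracE (xs @ [x]))"
    unfolding power_add[symmetric] using K' by (intro power_increasing) auto
  finally have 1: "\<bar>fst (fsum (xs @ [x]))\<bar> < 2 ^ data_size (listE fracE (xs @ [x]))" .
  have "\<bar>snd (fsum (xs @ [x]))\<bar> \<le> 2 ^ K * \<bar>snd x\<bar>"
    unfolding eq fadd_def using mult[OF S(2), of "snd x"] by (simp add: abs_mult)
  also have "\<dots> < 2 ^ K * 2 ^ (a + b + 1)" using sum by (intro mult_strict_left_mono) auto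
  also have "\<dots> \<le> 2 ^ data_size (listE fracE (xs @ [x]))"
    unfolding power_add[symmetric] using K' by (intro power_increasing) auto
  finally show ?case using 1 by simp
qed

lemma ptime_fsum: "ptime UNIV (listE fracE) fracE fsum"
  unfolding fsum_def
proof (rule ptime_fold[where f = "\<lambda>_ x s. fadd s x" and l = "\<lambda>x. x" and a = "\<lambda>_. (0, 1)"
      and b = "\<lambda>xs. 2 * data_size (listE fracE xs) + 3"])
  fix xs :: "frac list" and k
  define K where "K = data_size (listE fracE (take k xs))"
  \<comment> \<open>Origin of the constant 3: each integer exceeds the size of the list by at most
    one, and the pair needs a cell.\<close>
  have "int_size (fst (fsum (take k xs))) \<le> Suc K" "int_size (snd (fsum (take k xs))) \<le> Suc K"
    using fsum_bound[of "take k xs"] by (simp_all add: int_size_le_iff K_def)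
  moreover have "K \<le> data_size (listE fracE xs)" unfolding K_def by (rule listE_take_le)
  ultimately show "data_size (fracE (fold (\<lambda>x s. fadd s x) (take k xs) (0, 1)))
      \<le> 2 * data_size (listE fracE xs) + 3"
    by (simp add: pairE_def fsum_def)
qed (rule ptime_call2[OF ptime_fadd] ptime_rules pbound_intros)+

lemma ptime_lcost: "ptime UNIV labelE (pairE fracE fracE) lcost"
  unfolding lcost_def by (rule ptime_call[OF ptime_fsum] ptime_rules)+

lemma ptime_cle:
  "ptime UNIV (pairE (pairE fracE fracE) (pairE fracE fracE)) boolE (\<lambda>z. cle (fst z) (snd z))"
  unfolding cle_def by (rule ptime_call2[OF ptime_fle] ptime_rules)+

lemma ptime_refutes:
  "ptime UNIV (pairE (pairE fracE fracE) (pairE (pairE fracE fracE) (pairE fracE fracE))) boolE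
     (\<lambda>z. refutes (fst z) (fst (snd z)) (snd (snd z)))"
  unfolding refutes_def
  by (rule ptime_call2[OF ptime_fle] ptime_call2[OF ptime_cle] ptime_call2[OF ptime_fmul]
      ptime_call2[OF ptime_fsub] ptime_rules)+

lemma ptime_refutes':
  assumes "ptime D ea (pairE fracE fracE) f" "ptime D ea (pairE fracE fracE) g" "ptime D ea (pairE fracE fracE) h"
  shows "ptime D ea boolE (\<lambda>x. refutes (f x) (g x) (h x))"
  using ptime_call[OF ptime_refutes ptime_Pair[OF assms(1) ptime_Pair[OF assms(2,3)]]] by simp

lemma ptime_keep: "ptime UNIV (pairE (listE labelE) labelE) boolE (\<lambda>z. keep (fst z) (snd z))"
  unfolding keep_def by (rule ptime_call[OF ptime_lcost] ptime_refutes' ptime_rules)+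

lemma ptime_dedup: "ptime UNIV (listE labelE) (listE labelE) dedup"
  unfolding dedup_def
proof (rule ptime_fold[where l = "\<lambda>x. x" and a = "\<lambda>_. []" and b = "\<lambda>ls. data_size (listE labelE ls)"
      and f = "\<lambda>_ l acc. if list_ex (\<lambda>x. cle (lcost x) (lcost l) \<and> cle (lcost l) (lcost x)) acc then acc else l # acc"])
  \<comment> \<open>Whatever the test \<open>Q\<close>, only elements already read enter the
    accumulator.\<close>
  have le: "data_size (listE labelE (fold (\<lambda>l acc. if Q l acc then acc else l # acc) ls acc)) + 1
      \<le> data_size (listE labelE ls) + data_size (listE labelE acc)" for Q ls acc
  proof (induction ls arbitrary: acc)
    case Nil
    then show ?case by simp
  next
    case (Cons l ls)
    show ?case
    proof (cases "Q l acc")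
      case True
      then show ?thesis using Cons[of acc] by simp
    next
      case False
      then show ?thesis using Cons[of "l # acc"] by simp
    qed
  qed
  fix ls :: "label list" and k
  have "data_size (listE labelE (fold (\<lambda>l acc. if list_ex (\<lambda>x. cle (lcost x) (lcost l) \<and>
      cle (lcost l) (lcost x)) acc then acc else l # acc) (take k ls) [])) \<le> data_size (listE labelE (take k ls))"
    using le[of _ "take k ls" "[]"] by simp
  also have "\<dots> \<le> data_size (listE labelE ls)" by (rule listE_take_le)
  finally show "data_size (listE labelE (fold (\<lambda>l acc. if list_ex (\<lambda>x. cle (lcost x) (lcost l) \<and>
      cle (lcost l) (lcost x)) acc then acc else l # acc) (take k ls) [])) \<le> data_size (listE labelE ls)" .
qed (rule ptime_call[OF ptime_lcost] ptime_call2[OF ptime_cle] ptime_rules pbound_intros)+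

lemma ptime_prune: "ptime UNIV (listE labelE) (listE labelE) prune"
  unfolding prune_def by (rule ptime_call[OF ptime_dedup] ptime_call2[OF ptime_keep] ptime_rules)+

lemma ptime_labelled: "ptime UNIV (pairE (listE labelE) natE) boolE (\<lambda>z. labelled (fst z) (snd z))"
  unfolding labelled_def by (rule ptime_rules)+

lemma ptime_ready:
  "ptime UNIV (pairE (pairE (listE arcE) (listE labelE)) natE) boolE
     (\<lambda>z. ready (fst (fst z)) (snd (fst z)) (snd z))"
  unfolding ready_def by (rule ptime_call2[OF ptime_labelled] ptime_rules)+

lemma ptime_candidates:
  "ptime UNIV (pairE (pairE (listE arcE) (listE labelE)) natE) (listE labelE)
     (\<lambda>z. candidates (fst (fst z)) (snd (fst z)) (snd z))"
  unfolding candidates_def by (rule ptime_rules)+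

lemma ptime_dp_step:
  "ptime UNIV (pairE (pairE (pairE (listE arcE) natE) arcE) (listE labelE)) (listE labelE)
     (\<lambda>z. dp_step (fst (fst (fst z))) (snd (fst z)) (snd z))"
  unfolding dp_step_def
  by (rule ptime_call2[OF ptime_labelled] ptime_call3[OF ptime_ready] ptime_call3[OF ptime_candidates]
      ptime_call[OF ptime_prune] ptime_rules)+

text \<open>\<open>(S + 1) * S\<close> bounds the number of labels; \<open>2 * S + 2\<close> bounds
  a label with its list cell, allowing \<open>S\<close> for the node number and \<open>S\<close> for
  the path.\<close>

lemma (in dp) state_size:
  assumes inv: "invar st"
  defines "S \<equiv> data_size (pairE (listE arcE) natE (as, t))"
  shows "data_size (listE labelE st) \<le> Suc ((S + 1) * S * (2 * S + 2))"
proof -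
  have S: "data_size (listE arcE as) \<le> S" "data_size (natE t) \<le> S" by (simp_all add: S_def pairE_def)
  have "length as \<le> S" using length_le_listE[of as arcE] S by simp
  then have len: "length st \<le> (S + 1) * S"
    using length_state[OF inv] mult_le_mono[of "length as + 1" "S + 1" "length as" S] by simp
  have label: "Suc (data_size (labelE l)) \<le> 2 * S + 2" if l: "l \<in> set st" for l
  proof -
    have "l \<in> labels_at st (fst l)" using l by (simp add: labels_at_def)
    note l' = invarD[OF inv this]
    have sub: "set (snd l) \<subseteq> set as" and dist: "distinct (snd l)" using l'(2) distinct_path[OF inv l] by auto
    have "(\<Sum>a\<leftarrow>snd l. Suc (data_size (arcE a))) = (\<Sum>a\<in>set (snd l). Suc (data_size (arcE a)))"
      using dist by (simp add: sum_list_distinct_conv_sum_set)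
    also have "\<dots> \<le> (\<Sum>a\<in>set as. Suc (data_size (arcE a)))" using sub by (intro sum_mono2) auto
    also have "\<dots> = (\<Sum>a\<leftarrow>as. Suc (data_size (arcE a)))"
      using as(1) by (simp add: sum_list_distinct_conv_sum_set)
    finally have path: "data_size (listE arcE (snd l)) \<le> S"
      using S(1) unfolding data_size_listE by simp
    \<comment> \<open>A node number is either \<open>t\<close>, which \<open>S\<close> includes for
      this reason, or occurs in the input as the tail of an arc.\<close>
    have "data_size (natE (fst l)) \<le> S"
    proof (cases "fst l = t")
      case False
      then obtain i where "i \<in> arcs G" "tail G i = fst l" using out_arc[OF l'(1)] by blast
      then obtain a where a: "a \<in> set as" "atail a = fst l" using obtain_arc by metis
      have "data_size (natE (atail a)) \<le> data_size (arcE a)" by (simp add: pairE_def)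
      then show ?thesis using a elem_le_listE[OF a(1), of arcE] S(1) by simp
    qed (simp add: S)
    then show ?thesis using path by (simp add: pairE_def)
  qed
  have "(\<Sum>l\<leftarrow>st. Suc (data_size (labelE l))) \<le> (\<Sum>l\<leftarrow>st. 2 * S + 2)"
    using label by (rule sum_list_mono)
  also have "\<dots> = length st * (2 * S + 2)" by (simp add: sum_list_triv)
  also have "\<dots> \<le> (S + 1) * S * (2 * S + 2)" using len by (rule mult_le_mono1)
  finally show ?thesis unfolding data_size_listE by simp
qed

text \<open>The states are known to stay small only for arc lists of suitable graphs, hence the
  domain \<open>D\<close>. A prefix of the flattened rounds may stop inside a pass, but the
  invariant holds there too.\<close>

lemma ptime_dp_run:
  assumes "\<And>z. z \<in> D \<Longrightarrow> \<exists>G s c d. dp G s (snd z) c d (fst z)"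
  shows "ptime D (pairE (listE arcE) natE) (listE labelE) (\<lambda>z. dp_run (fst z) (snd z))"
  unfolding dp_run_def
proof (rule ptime_fold[where f = "\<lambda>z. dp_step (fst z)" and
      b = "\<lambda>z. Suc ((data_size (pairE (listE arcE) natE z) + 1) * data_size (pairE (listE arcE) natE z) *
         (2 * data_size (pairE (listE arcE) natE z) + 2))"])
  fix z k assume "z \<in> D"
  then obtain G s c d where "dp G s (snd z) c d (fst z)" using assms by blast
  then interpret dp G s "snd z" c d "fst z" .
  have "set (take k (concat (map (\<lambda>_. fst z) (fst z)))) \<subseteq> set (fst z)"
    by (rule order_trans[OF set_take_subset]) (auto split: if_splits)
  from state_size[OF invar_fold[OF invar_init this]]
  show "data_size (listE labelE (fold (dp_step (fst z)) (take k (concat (map (\<lambda>_. fst z) (fst z)))) [(snd z, [])]))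
    \<le> Suc ((data_size (pairE (listE arcE) natE z) + 1) * data_size (pairE (listE arcE) natE z) *
         (2 * data_size (pairE (listE arcE) natE z) + 2))" by simp
qed (rule ptime_dp_step ptime_rules pbound_intros)+

lemma ptime_paths_at: "ptime UNIV (pairE natE (listE labelE)) (listE (listE natE)) (\<lambda>z. paths_at (fst z) (snd z))"
  unfolding paths_at_def by (rule ptime_rules)+

lemma enumerate_arcs_eq: "enumerate_arcs rs = rev (zip [0..<length rs] rs)"
proof -
  have "fold (\<lambda>r s. (Suc (fst s), (fst s, r) # snd s)) rs (0, []) = (length rs, rev (zip [0..<length rs] rs))"
    by (induction rs rule: rev_induct) auto
  then show ?thesis by (simp add: enumerate_arcs_def)
qed

lemma data_size_natE: "data_size (natE n) \<le> Suc n"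
  by (simp add: natE_def int_size_le_iff)

lemma ptime_enumerate_arcs: "ptime UNIV (listE recE) (listE arcE) enumerate_arcs"
proof -
  define step where "step r s = (Suc (fst s), (fst s, r) # snd s)" for r and s :: "nat \<times> arc list"
  have bound: "fst (fold step rs (0, [])) = length rs \<and>
      data_size (listE arcE (snd (fold step rs (0, []))))
      \<le> data_size (listE recE rs) + length rs * (length rs + 3)" for rs
  proof (induction rs rule: rev_induct)
    case (snoc r rs)
    have eq: "fold step (rs @ [r]) (0, []) = (Suc (length rs), (length rs, r) # snd (fold step rs (0, [])))"
      using snoc by (simp add: step_def[of r])
    have "data_size (arcE (length rs, r)) = Suc (data_size (natE (length rs)) + data_size (recE r))"
      by (subst pairE_def) simp
    moreover have "data_size (listE recE (rs @ [r])) = data_size (listE recE rs) + Suc (data_size (recE r))"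
      by (simp add: data_size_listE)
    ultimately show ?case using snoc data_size_natE[of "length rs"] unfolding eq by (simp add: algebra_simps)
  qed simp
  have "ptime UNIV (listE recE) (pairE natE (listE arcE)) (\<lambda>rs. fold step rs (0, []))"
  proof (rule ptime_fold[where f = "\<lambda>_. step" and l = "\<lambda>x. x" and a = "\<lambda>_. (0, [])"
        and b = "\<lambda>rs. data_size (listE recE rs) + data_size (listE recE rs) * (data_size (listE recE rs) + 3) +
          data_size (listE recE rs) + 2"])
    fix rs :: "(nat \<times> nat \<times> frac \<times> frac \<times> unit) list" and k
    define n where "n = data_size (listE recE rs)"
    have n: "length (take k rs) \<le> n" "data_size (listE recE (take k rs)) \<le> n"
      using length_le_listE[of "take k rs" recE] listE_take_le[of recE k rs] by (auto simp: n_def)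
    have "data_size (listE arcE (snd (fold step (take k rs) (0, [])))) \<le> n + n * (n + 3)"
      using bound[of "take k rs"] n mult_le_mono[OF n(1), of "length (take k rs) + 3" "n + 3"] by linarith
    moreover have "data_size (natE (fst (fold step (take k rs) (0, [])))) \<le> Suc n"
      using bound[of "take k rs"] n data_size_natE[of "length (take k rs)"] by simp
    ultimately show "data_size (pairE natE (listE arcE) (fold step (take k rs) (0, []))) \<le>
        data_size (listE recE rs) + data_size (listE recE rs) * (data_size (listE recE rs) + 3) +
          data_size (listE recE rs) + 2"
      by (simp add: pairE_def n_def)
  qed (unfold step_def, (rule ptime_rules pbound_intros)+)
  then have "ptime UNIV (listE recE) (listE arcE) (\<lambda>rs. snd (fold step rs (0, [])))"
    by (rule ptime_snd)
  moreover have "enumerate_arcs = (\<lambda>rs. snd (fold step rs (0, [])))"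
    by (simp add: enumerate_arcs_def fun_eq_iff step_def[abs_def])
  ultimately show ?thesis by simp
qed

section \<open>From the encoded instance to the solution\<close>

definition inst_recs :: "sp_instance \<Rightarrow> (nat \<times> nat \<times> frac \<times> frac \<times> unit) list" where
  "inst_recs = (\<lambda>(G, s, t, c, d).
     map (\<lambda>e. (tail G e, head G e, quotient_of (c e), quotient_of (d e), ())) [0..<card (arcs G)])"

definition inst_tuple ::
  "sp_instance \<Rightarrow> nat \<times> nat \<times> nat \<times> (nat \<times> nat \<times> frac \<times> frac \<times> unit) list \<times> unit" where
  "inst_tuple = (\<lambda>x. case x of (G, s, t, c, d) \<Rightarrow> (card (verts G), s, t, inst_recs x, ()))"

definition solve :: "sp_instance \<Rightarrow> nat list list" where
  "solve x = paths_at (fst (snd (inst_tuple x)))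
     (dp_run (enumerate_arcs (fst (snd (snd (snd (inst_tuple x)))))) (fst (snd (snd (inst_tuple x)))))"

lemma rat_data_eq: "rat_data r = fracE (quotient_of r)"
  by (simp add: rat_data_def pairE_def split_def)

text \<open>Lists of fixed length are nested pairs ending in \<open>IntD 0\<close>, so the machine
  input already is the encoding of \<open>inst_tuple\<close>, and its fields are reached by
  projections.\<close>

lemma encode_instance_eq:
  "encode_instance x = pairE natE (pairE natE (pairE natE (pairE (listE recE) unitE))) (inst_tuple x)"
  by (cases x) (simp add: encode_instance_def inst_tuple_def inst_recs_def pairE_def natE_def unitE_def
      listE_def rat_data_eq o_def)

lemma fval_quotient_of: "fval (quotient_of r) = of_rat r"
proof -
  have "r = of_int (fst (quotient_of r)) / of_int (snd (quotient_of r))"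
    using quotient_of_div[of r] by simp
  then show ?thesis unfolding fval_def by (metis of_rat_divide of_rat_of_int_eq)
qed

text \<open>Hands the bounds for series-parallel graphs over to the algorithm.\<close>

lemma dp_instance:
  assumes "(G, s, t, c, d) \<in> sp_instances"
  shows "dp G s t (\<lambda>e. of_rat (c e)) (\<lambda>e. of_rat (d e)) (enumerate_arcs (inst_recs (G, s, t, c, d)))"
    (is "dp G s t ?c ?d ?as")
proof -
  define M where "M = card (arcs G)"
  have sp: "series_parallel G s t" and M: "arcs G = {..<M}" using assms by (auto simp: sp_instances_def M_def)
  interpret st_dag G s t using sp by (rule series_parallel_st_dag)
  define mk where "mk i = (i, tail G i, head G i, quotient_of (c i), quotient_of (d i), ())" for i
  have "zip xs (map h xs) = map (\<lambda>i. (i, h i)) xs" for h :: "nat \<Rightarrow> nat \<times> nat \<times> frac \<times> frac \<times> unit" and xs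
    by (induction xs) auto
  then have as: "?as = rev (map mk [0..<M])"
    by (simp add: enumerate_arcs_eq inst_recs_def M_def mk_def)
  then have len: "length ?as = card (arcs G)" by (simp add: M_def)
  have set_as: "set ?as = mk ` {..<M}" by (simp add: as atLeast0LessThan)
  have sv: "card (verts G) \<le> card (arcs G) + 1"
    "\<And>v. v \<in> verts G \<Longrightarrow> walks G v t \<noteq> {}"
    "\<And>v. v \<in> verts G \<Longrightarrow> card (envelope (costs ?c ?d G v t)) \<le> card (arcs G)"
    using series_parallel_envelope[OF sp, of ?c ?d] by blast+
  show ?thesis
  proof unfold_locales
    show "distinct ?as" by (auto simp: as distinct_map inj_on_def mk_def)
    show "inj_on aidx (set ?as)" by (auto simp: set_as inj_on_def mk_def)
    show "aidx ` set ?as = arcs G" by (simp add: set_as image_image mk_def M)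
    show "atail a = tail G (aidx a) \<and> ahead a = head G (aidx a) \<and> fpos (acost a) \<and> fpos (adev a) \<and>
        fval (acost a) = ?c (aidx a) \<and> fval (adev a) = ?d (aidx a)" if a: "a \<in> set ?as" for a
    proof -
      obtain i where "a = mk i" using a unfolding set_as by blast
      then show ?thesis by (simp add: mk_def fval_quotient_of fpos_def quotient_of_denom_pos')
    qed
  qed (use sv len in auto)
qed

lemma ptime_solve: "ptime sp_instances encode_instance (listE (listE natE)) solve"
proof -
  let ?E = "pairE natE (pairE natE (pairE natE (pairE (listE recE) unitE)))"
  have tuple: "ptime sp_instances encode_instance ?E inst_tuple"
    by (rule ptime_cong[OF ptime_id]) (rule encode_instance_eq)
  have arg: "ptime sp_instances encode_instance (pairE (listE arcE) natE)
      (\<lambda>x. (enumerate_arcs (fst (snd (snd (snd (inst_tuple x))))), fst (snd (snd (inst_tuple x)))))"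
    by (rule tuple ptime_call[OF ptime_enumerate_arcs] ptime_rules)+
  \<comment> \<open>The image of the instances, on which the states of \<open>dp_run\<close> are
    polynomially bounded.\<close>
  let ?D = "(\<lambda>x. (enumerate_arcs (fst (snd (snd (snd (inst_tuple x))))), fst (snd (snd (inst_tuple x))))) ` sp_instances"
  have "\<exists>G s c d. dp G s (snd z) c d (fst z)" if "z \<in> ?D" for z
  proof -
    obtain G s t c d where x: "(G, s, t, c, d) \<in> sp_instances"
      "z = (enumerate_arcs (inst_recs (G, s, t, c, d)), t)"
      using \<open>z \<in> ?D\<close> by (auto simp: inst_tuple_def)
    then show ?thesis using dp_instance[OF x(1)] by auto
  qed
  from ptime_comp[OF arg ptime_dp_run[of ?D, OF this]]
  have "ptime sp_instances encode_instance (listE labelE)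
      (\<lambda>x. dp_run (enumerate_arcs (fst (snd (snd (snd (inst_tuple x)))))) (fst (snd (snd (inst_tuple x)))))"
    by simp
  then show ?thesis
    unfolding solve_def by (rule ptime_call2[OF ptime_paths_at, rotated]) (rule tuple ptime_rules)+
qed

lemma solve_correct:
  assumes "x \<in> sp_instances"
  shows "encodes_solution x (listE (listE natE) (solve x))"
proof -
  obtain G s t c d where x: "x = (G, s, t, c, d)" by (cases x)
  interpret dp G s t "\<lambda>e. of_rat (c e)" "\<lambda>e. of_rat (d e)" "enumerate_arcs (inst_recs x)"
    using dp_instance assms unfolding x by blast
  have "\<forall>e\<in>arcs G. 0 \<le> real_of_rat (d e)" using assms by (auto simp: x sp_instances_def)
  note correct = paths_at_correct[OF this]
  have "solve x = paths_at s (dp_run (enumerate_arcs (inst_recs x)) t)"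
    by (simp add: solve_def x inst_tuple_def)
  moreover have "listE (listE natE) Ps = list_data (map (\<lambda>P. list_data (map nat_data P)) Ps)" for Ps
    by (simp add: listE_def[abs_def] natE_def[abs_def])
  ultimately show ?thesis
    using correct unfolding encodes_solution_def x by auto
qed

theorem theorem9:
  "(\<forall>(G :: ('a, 'b) pre_digraph) s t (c :: 'b \<Rightarrow> real) (d :: 'b \<Rightarrow> real) E.
      series_parallel G s t \<longrightarrow> (\<forall>e\<in>arcs G. 0 \<le> c e \<and> 0 \<le> d e) \<longrightarrow> is_E_min G s t c d E \<longrightarrow>
      finite E \<and> int (card E) \<le> int (card (arcs G)) - int (card (verts G)) + 2) \<and>
   polynomial_time_solvable sp_instances encode_instance encodes_solution"
proof
  show "polynomial_time_solvable sp_instances encode_instance encodes_solution"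
    by (rule polynomial_time_solvableI[OF ptime_solve]) (rule solve_correct)
qed (intro allI impI, rule card_E_min)

end
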